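(* $FLO<_c FVS$, i.e. $FLO\le_c FVS$ and $FVS\not\le_c FLO$.
   Context: Conventions: every structure is for a finite relational language and has universe a subset of $\omega$; a class of structures is a collection of structures for one fixed finite relational language closed under isomorphism. $D(\mathcal{A})$ is the atomic diagram of $\mathcal{A}$. A computable transformation from $K$ to $K'$ is a c.e. set $\Phi$ of pairs $(\alpha,\varphi)$, $\alpha$ a finite subset of the atomic diagram of a finite structure in the language of $K$, $\varphi$ an atomic sentence or negation of one in the language of $K'$, such that for every $\mathcal{A}\in K$, $\{\varphi:(\exists\alpha\subseteq D(\mathcal{A}))(\alpha,\varphi)\in\Phi\}=D(\mathcal{B})$ for some $\mathcal{B}\in K'$, written $\Phi(\mathcal{A})=\mathcal{B}$. A computable embedding is a computable transformation with $\mathcal{A}\cong\mathcal{A}'\iff\Phi(\mathcal{A})\cong\Phi(\mathcal{A}')$; $K\le_c K'$ means one exists; $K<_c K'$ means $K\le_c K'$ and $K'\not\le_c K$. $FLO$ is the class of finite linear orders. $FVS$ is the class of finite-dimensional vector spaces over $\mathbb{Q}$, viewed as structures in the finite relational language with unary predicates $V$ (vectors) and $F$ (scalars) and relations representing (as graphs) the field constants $0_F,1_F$, field addition and multiplication, the zero vector, vector addition, and scalar multiplication; the scalar part is a copy of the field $\mathbb{Q}$. *)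

theory Defs
  imports Main "HOL-Library.Countable" "HOL-Library.Nat_Bijection"
begin

datatype recf = Zero | Succ | Proj nat | Comp recf "recf list" | Prim recf recf | Mu recf

inductive evalr :: "recf \<Rightarrow> nat list \<Rightarrow> nat \<Rightarrow> bool" where
  evalr_zero: "evalr Zero xs 0"
| evalr_succ: "evalr Succ (x # xs) (Suc x)"
| evalr_proj: "i < length xs \<Longrightarrow> evalr (Proj i) xs (xs ! i)"
| evalr_comp: "list_all2 (\<lambda>g y. evalr g xs y) gs ys \<Longrightarrow> evalr f ys z \<Longrightarrow> evalr (Comp f gs) xs z"
| evalr_prim0: "evalr g xs y \<Longrightarrow> evalr (Prim g h) (0 # xs) y"
| evalr_primS: "evalr (Prim g h) (n # xs) y \<Longrightarrow> evalr h (y # n # xs) z \<Longrightarrow>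
                 evalr (Prim g h) (Suc n # xs) z"
| evalr_mu: "evalr f (n # xs) 0 \<Longrightarrow> (\<forall>m<n. \<exists>y. 0 < y \<and> evalr f (m # xs) y) \<Longrightarrow>
              evalr (Mu f) xs n"

definition ce :: "nat set \<Rightarrow> bool" where
  "ce S \<longleftrightarrow> (\<exists>f. \<forall>n. n \<in> S \<longleftrightarrow> (\<exists>y. evalr f [n] y))"

text \<open>A language (signature) is the list of arities of its relation symbols 0..length-1.
  A structure is a pair (universe, interpretation); relation symbol i is interpreted
  as a set of tuples (lists) of elements.\<close>
type_synonym sig = "nat list"
type_synonym struc = "nat set \<times> (nat \<Rightarrow> nat list set)"

definition is_struc :: "sig \<Rightarrow> struc \<Rightarrow> bool" where
  "is_struc L A \<longleftrightarrow>
     (\<forall>i < length L. \<forall>xs \<in> snd A i. length xs = L ! i \<and> set xs \<subseteq> fst A) \<and>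
     (\<forall>i \<ge> length L. snd A i = {})"

definition iso :: "sig \<Rightarrow> struc \<Rightarrow> struc \<Rightarrow> bool" where
  "iso L A B \<longleftrightarrow> (\<exists>f. bij_betw f (fst A) (fst B) \<and>
     (\<forall>i < length L. \<forall>xs. length xs = L ! i \<and> set xs \<subseteq> fst A \<longrightarrow>
        (xs \<in> snd A i \<longleftrightarrow> map f xs \<in> snd B i)))"

text \<open>Atomic sentences with constants for natural numbers; a literal is (polarity, atom):
  (True, a) is the atomic sentence a, (False, a) its negation.\<close>
datatype atom = Eq nat nat | Rel nat "nat list"
type_synonym lit = "bool \<times> atom"

definition atoms :: "sig \<Rightarrow> nat set \<Rightarrow> atom set" where
  "atoms L U = {Eq a b | a b. a \<in> U \<and> b \<in> U} \<union>
               {Rel i xs | i xs. i < length L \<and> length xs = L ! i \<and> set xs \<subseteq> U}"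

fun holds :: "struc \<Rightarrow> atom \<Rightarrow> bool" where
  "holds A (Eq a b) = (a = b)"
| "holds A (Rel i xs) = (xs \<in> snd A i)"

definition diag :: "sig \<Rightarrow> struc \<Rightarrow> lit set" where
  "diag L A = {(holds A a, a) | a. a \<in> atoms L (fst A)}"

fun lit_in_lang :: "sig \<Rightarrow> lit \<Rightarrow> bool" where
  "lit_in_lang L (b, Eq x y) = True"
| "lit_in_lang L (b, Rel i xs) = (i < length L \<and> length xs = L ! i)"

fun atom_code :: "atom \<Rightarrow> nat" where
  "atom_code (Eq a b) = sum_encode (Inl (prod_encode (a, b)))"
| "atom_code (Rel i xs) = sum_encode (Inr (prod_encode (i, list_encode xs)))"

definition lit_code :: "lit \<Rightarrow> nat" where
  "lit_code l = prod_encode (if fst l then 1 else 0, atom_code (snd l))"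

definition pair_code :: "lit set \<times> lit \<Rightarrow> nat" where
  "pair_code p = prod_encode (set_encode (lit_code ` fst p), lit_code (snd p))"

definition apply_trans :: "sig \<Rightarrow> (lit set \<times> lit) set \<Rightarrow> struc \<Rightarrow> lit set" where
  "apply_trans L \<Phi> A = {\<phi>. \<exists>\<alpha>. \<alpha> \<subseteq> diag L A \<and> (\<alpha>, \<phi>) \<in> \<Phi>}"

definition comp_trans :: "sig \<Rightarrow> struc set \<Rightarrow> sig \<Rightarrow> struc set \<Rightarrow> (lit set \<times> lit) set \<Rightarrow> bool" where
  "comp_trans L K L' K' \<Phi> \<longleftrightarrow>
     ce (pair_code ` \<Phi>) \<and>
     (\<forall>(\<alpha>, \<phi>) \<in> \<Phi>. finite \<alpha> \<and>
        (\<exists>B. is_struc L B \<and> finite (fst B) \<and> \<alpha> \<subseteq> diag L B) \<and> lit_in_lang L' \<phi>) \<and>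
     (\<forall>A \<in> K. \<exists>B \<in> K'. apply_trans L \<Phi> A = diag L' B)"

definition comp_emb :: "sig \<Rightarrow> struc set \<Rightarrow> sig \<Rightarrow> struc set \<Rightarrow> (lit set \<times> lit) set \<Rightarrow> bool" where
  "comp_emb L K L' K' \<Phi> \<longleftrightarrow> comp_trans L K L' K' \<Phi> \<and>
     (\<forall>A \<in> K. \<forall>A' \<in> K. \<forall>B B'. is_struc L' B \<and> is_struc L' B' \<and>
        apply_trans L \<Phi> A = diag L' B \<and> apply_trans L \<Phi> A' = diag L' B' \<longrightarrow>
        (iso L A A' \<longleftrightarrow> iso L' B B'))"

definition le_c :: "sig \<Rightarrow> struc set \<Rightarrow> sig \<Rightarrow> struc set \<Rightarrow> bool" where
  "le_c L K L' K' \<longleftrightarrow> (\<exists>\<Phi>. comp_emb L K L' K' \<Phi>)"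

definition flo_sig :: sig where "flo_sig = [2]"

definition FLO :: "struc set" where
  "FLO = {A. is_struc flo_sig A \<and> finite (fst A) \<and>
     (let U = fst A; le = (\<lambda>a b. [a, b] \<in> snd A 0) in
       (\<forall>a\<in>U. le a a) \<and> (\<forall>a\<in>U. \<forall>b\<in>U. le a b \<and> le b a \<longrightarrow> a = b) \<and>
       (\<forall>a\<in>U. \<forall>b\<in>U. \<forall>c\<in>U. le a b \<and> le b c \<longrightarrow> le a c) \<and>
       (\<forall>a\<in>U. \<forall>b\<in>U. le a b \<or> le b a))}"

text \<open>Symbols: 0 = V (vectors), 1 = F (scalars), 2 = graph of 0_F, 3 = graph of 1_F,
  4 = graph of field addition, 5 = graph of field multiplication, 6 = graph of the zero vector,
  7 = graph of vector addition, 8 = graph of scalar multiplication (scalar, vector, result).\<close>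
definition fvs_sig :: sig where "fvs_sig = [1, 1, 1, 1, 3, 3, 1, 3, 3]"

definition enc :: "rat + rat list \<Rightarrow> nat" where "enc = to_nat"

definition std_vs :: "nat \<Rightarrow> struc" where
  "std_vs n = (enc ` (range Inl \<union> Inr ` {v. length v = n}),
     (\<lambda>i. if i = 0 then {[enc (Inr v)] | v. length v = n}
          else if i = 1 then {[enc (Inl q)] | q. True}
          else if i = 2 then {[enc (Inl 0)]}
          else if i = 3 then {[enc (Inl 1)]}
          else if i = 4 then {[enc (Inl p), enc (Inl q), enc (Inl (p + q))] | p q. True}
          else if i = 5 then {[enc (Inl p), enc (Inl q), enc (Inl (p * q))] | p q. True}
          else if i = 6 then {[enc (Inr (replicate n 0))]}
          else if i = 7 then {[enc (Inr v), enc (Inr w), enc (Inr (map2 (+) v w))] | v w.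
                                length v = n \<and> length w = n}
          else if i = 8 then {[enc (Inl a), enc (Inr v), enc (Inr (map ((*) a) v))] | a v.
                                length v = n}
          else {}))"

definition FVS :: "struc set" where
  "FVS = {A. is_struc fvs_sig A \<and> (\<exists>n. iso fvs_sig A (std_vs n))}"

end

theory Submission
  imports Defs
begin

text \<open>
  A finite order with universe \<open>U\<close> is sent to the rational vector space with basis \<open>U\<close>, realised as
  the substructure of a fixed decidable copy of \<open>\<rat>\<^sup>(\<^sup>\<omega>\<^sup>)\<close> given by the vectors supported in \<open>U\<close>.
  A literal about such vectors only needs the facts \<open>a = a\<close> for \<open>a\<close> in their supports, so this is a
  computable transformation, and it preserves and reflects isomorphism because finite orders are
  classified by cardinality and finite-dimensional spaces by dimension.

  Conversely, let \<open>\<Phi>\<close> be an embedding of \<open>FVS\<close> into \<open>FLO\<close>, and let a line \<open>A\<^sub>1\<close> sit inside a plane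
  \<open>A\<^sub>2\<close>. By monotonicity \<open>\<Phi>(A\<^sub>1)\<close> is a suborder of \<open>\<Phi>(A\<^sub>2)\<close>. The universe of the finite order
  \<open>\<Phi>(A\<^sub>2)\<close> is forced by finitely many literals of \<open>A\<^sub>2\<close>, and a generic linear projection of the plane to
  a line respects these literals, so they belong to the diagram of some line \<open>A\<^sub>3\<close>. Hence
  \<open>\<Phi>(A\<^sub>3) \<cong> \<Phi>(A\<^sub>1)\<close> is at least as large as \<open>\<Phi>(A\<^sub>2)\<close>, the orders \<open>\<Phi>(A\<^sub>1)\<close> and \<open>\<Phi>(A\<^sub>2)\<close> are
  isomorphic, and so would be the line and the plane.
\<close>

section \<open>Total computable functions\<close>

definition computable :: "nat \<Rightarrow> (nat list \<Rightarrow> nat) \<Rightarrow> bool" where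
  "computable k f \<longleftrightarrow> (\<exists>r. \<forall>xs. length xs = k \<longrightarrow> evalr r xs (f xs))"

text \<open>Truth values are 0 and 1, so negation becomes subtraction from 1, conjunction a product,
  and a bounded quantifier an iterated product.\<close>

definition decidable :: "nat \<Rightarrow> (nat list \<Rightarrow> bool) \<Rightarrow> bool" where
  "decidable k P \<longleftrightarrow> computable k (\<lambda>xs. of_bool (P xs))"

lemma computable_cong:
  assumes "computable k f" and "\<And>xs. length xs = k \<Longrightarrow> f xs = g xs"
  shows "computable k g"
proof -
  obtain r where "\<forall>xs. length xs = k \<longrightarrow> evalr r xs (f xs)"
    using assms(1) unfolding computable_def by blast
  then have "\<forall>xs. length xs = k \<longrightarrow> evalr r xs (g xs)" using assms(2) by simp
  then show ?thesis unfolding computable_def by blast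
qed

lemma computable_zero: "computable k (\<lambda>_. 0)"
  unfolding computable_def using evalr_zero by blast

lemma computable_nth: "i < k \<Longrightarrow> computable k (\<lambda>xs. xs ! i)"
  unfolding computable_def using evalr_proj by metis

lemma computable_compose:
  assumes f: "computable (length gs) f" and gs: "\<forall>g \<in> set gs. computable k g"
  shows "computable k (\<lambda>xs. f (map (\<lambda>g. g xs) gs))"
proof -
  obtain r where r: "\<And>xs. length xs = length gs \<Longrightarrow> evalr r xs (f xs)"
    using f unfolding computable_def by blast
  from gs have "\<forall>g\<in>set gs. \<exists>r. \<forall>xs. length xs = k \<longrightarrow> evalr r xs (g xs)"
    unfolding computable_def .
  then obtain c where c: "\<And>g xs. g \<in> set gs \<Longrightarrow> length xs = k \<Longrightarrow> evalr (c g) xs (g xs)"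
    by metis
  have "evalr (Comp r (map c gs)) xs (f (map (\<lambda>g. g xs) gs))" if "length xs = k" for xs
    by (rule evalr_comp[where ys = "map (\<lambda>g. g xs) gs"])
       (auto simp: list_all2_map1 list_all2_map2 list_all2_same c that r)
  then show ?thesis unfolding computable_def by blast
qed

lemma computable_compose1:
  assumes "computable 1 (\<lambda>xs. F (xs ! 0))" "computable k f"
  shows "computable k (\<lambda>xs. F (f xs))"
  using computable_compose[of "[f]" "\<lambda>xs. F (xs ! 0)" k] assms by simp

lemma computable_compose2:
  assumes "computable 2 (\<lambda>xs. F (xs ! 0) (xs ! 1))" "computable k f" "computable k g"
  shows "computable k (\<lambda>xs. F (f xs) (g xs))"
  using computable_compose[of "[f, g]" "\<lambda>xs. F (xs ! 0) (xs ! 1)" k] assms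
  by (simp add: numeral_2_eq_2)

text \<open>Weakening. A bounded quantifier or a search puts its variable in front of the argument
  list, so a function of the outer variables recurs under the binder as a function of the
  tail.\<close>

lemma computable_tl: "computable k f \<Longrightarrow> computable (Suc k) (\<lambda>ys. f (tl ys))"
proof -
  assume f: "computable k f"
  have "computable (Suc k) (\<lambda>ys. f (map (\<lambda>g. g ys) (map (\<lambda>i ys. ys ! Suc i) [0..<k])))"
    by (rule computable_compose) (auto simp: f intro: computable_nth)
  then show ?thesis
    by (rule computable_cong)
       (auto simp: o_def nth_tl intro!: arg_cong[where f = f] nth_equalityI)
qed

lemma computable_Suc: "computable k f \<Longrightarrow> computable k (\<lambda>xs. Suc (f xs))"
proof (erule computable_compose1[rotated])
  show "computable 1 (\<lambda>xs. Suc (xs ! 0))"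
    unfolding computable_def
    by (rule exI[of _ Succ]) (auto simp: length_Suc_conv intro: evalr_succ)
qed

lemma computable_const: "computable k (\<lambda>_. c)"
  by (induction c) (auto intro: computable_zero computable_Suc)

text \<open>The step hypothesis follows the calling convention of \<open>Prim\<close>: recursive
  value first, counter second, parameters last.\<close>

lemma computable_rec:
  assumes n: "computable k n" and a: "computable k a"
    and h: "computable (Suc (Suc k)) (\<lambda>ys. h (ys ! 1) (ys ! 0) (tl (tl ys)))"
  shows "computable k (\<lambda>xs. rec_nat (a xs) (\<lambda>i y. h i y xs) (n xs))"
proof -
  obtain ra where ra: "\<And>xs. length xs = k \<Longrightarrow> evalr ra xs (a xs)"
    using a unfolding computable_def by blast
  obtain rh where rh: "\<And>xs. length xs = Suc (Suc k) \<Longrightarrow> evalr rh xs (h (xs ! 1) (xs ! 0) (tl (tl xs)))"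
    using h unfolding computable_def by blast
  have "evalr (Prim ra rh) (m # xs) (rec_nat (a xs) (\<lambda>i y. h i y xs) m)" if "length xs = k" for m xs
  proof (induction m)
    case 0
    show ?case using ra[OF that] by (simp add: evalr_prim0)
  next
    case (Suc m)
    show ?case
      using evalr_primS[OF Suc] rh[of "rec_nat (a xs) (\<lambda>i y. h i y xs) m # m # xs"] that by simp
  qed
  then have "computable (Suc k) (\<lambda>ys. rec_nat (a (tl ys)) (\<lambda>i y. h i y (tl ys)) (ys ! 0))"
    unfolding computable_def
    by (intro exI[of _ "Prim ra rh"]) (auto simp: length_Suc_conv)
  \<comment> \<open>\<open>Prim\<close> counts on its first argument; composing with
    \<open>n\<close> and the projections installs \<open>n xs\<close> as the counter and keeps
    \<open>xs\<close> as parameters.\<close>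
  then have "computable (length (n # map (\<lambda>i xs. xs ! i) [0..<k]))
      (\<lambda>ys. rec_nat (a (tl ys)) (\<lambda>i y. h i y (tl ys)) (ys ! 0))" by simp
  then have "computable k (\<lambda>xs. (\<lambda>ys. rec_nat (a (tl ys)) (\<lambda>i y. h i y (tl ys)) (ys ! 0))
      (map (\<lambda>g. g xs) (n # map (\<lambda>i xs. xs ! i) [0..<k])))"
    by (rule computable_compose) (auto simp: n intro: computable_nth)
  then show ?thesis
  proof (rule computable_cong)
    fix xs :: "nat list" assume "length xs = k"
    then have "map (\<lambda>i. xs ! i) [0..<k] = xs" by (metis map_nth)
    then show "(\<lambda>ys. rec_nat (a (tl ys)) (\<lambda>i y. h i y (tl ys)) (ys ! 0))
      (map (\<lambda>g. g xs) (n # map (\<lambda>i xs. xs ! i) [0..<k])) = rec_nat (a xs) (\<lambda>i y. h i y xs) (n xs)"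
      by (simp add: o_def)
  qed
qed

lemma computable_add:
  assumes "computable k f" "computable k g" shows "computable k (\<lambda>xs. f xs + g xs)"
proof -
  have "computable k (\<lambda>xs. rec_nat (f xs) (\<lambda>i y. Suc y) (g xs))"
    by (rule computable_rec) (auto intro: assms computable_Suc computable_nth)
  moreover have "rec_nat a (\<lambda>i y. Suc y) b = a + b" for a b by (induction b) auto
  ultimately show ?thesis by simp
qed

lemma computable_mult:
  assumes "computable k f" "computable k g" shows "computable k (\<lambda>xs. f xs * g xs)"
proof -
  have "computable k (\<lambda>xs. rec_nat 0 (\<lambda>i y. y + f xs) (g xs))"
    by (rule computable_rec)
       (auto intro!: assms computable_add computable_nth computable_zero computable_tl)
  moreover have "rec_nat 0 (\<lambda>i y. y + a) b = a * b" for a b :: nat by (induction b) auto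
  ultimately show ?thesis by simp
qed

lemma computable_diff:
  assumes "computable k f" "computable k g" shows "computable k (\<lambda>xs. f xs - g xs)"
proof -
  \<comment> \<open>A recursion that discards its previous value and returns the counter is the
    predecessor, with 0 sent to 0. Iterating it gives truncated subtraction.\<close>
  have "computable m (\<lambda>xs. rec_nat 0 (\<lambda>i y. i) (h xs))" if "computable m h" for m h
    by (rule computable_rec) (auto intro: that computable_nth computable_zero)
  moreover have "rec_nat 0 (\<lambda>i y. i) b = b - 1" for b :: nat by (cases b) auto
  ultimately have pred: "computable m (\<lambda>xs. h xs - 1)" if "computable m h" for m h
    using that by simp
  have "computable k (\<lambda>xs. rec_nat (f xs) (\<lambda>i y. y - 1) (g xs))"
    by (rule computable_rec) (auto intro!: assms pred[simplified] computable_nth)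
  moreover have "rec_nat a (\<lambda>i y. y - 1) b = a - b" for a b :: nat by (induction b) auto
  ultimately show ?thesis by simp
qed

lemma computable_power2:
  assumes "computable k f" shows "computable k (\<lambda>xs. 2 ^ f xs)"
proof -
  have "computable k (\<lambda>xs. rec_nat 1 (\<lambda>i y. y + y) (f xs))"
    by (rule computable_rec) (auto intro!: assms computable_const computable_add computable_nth)
  moreover have "rec_nat 1 (\<lambda>i y. y + y) b = (2 ^ b :: nat)" for b by (induction b) auto
  ultimately show ?thesis by simp
qed

lemma computable_of_bool: "decidable k P \<Longrightarrow> computable k (\<lambda>xs. of_bool (P xs))"
  unfolding decidable_def .

lemma decidable_compose2:
  assumes "decidable 2 (\<lambda>xs. P (xs ! 0) (xs ! 1))" "computable k f" "computable k g"
  shows "decidable k (\<lambda>xs. P (f xs) (g xs))"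
  using assms computable_compose2[of "\<lambda>a b. of_bool (P a b)"] by (simp add: decidable_def)

lemma decidable_eq:
  assumes "computable k f" "computable k g" shows "decidable k (\<lambda>xs. f xs = g xs)"
proof -
  \<comment> \<open>At least one of the two truncated differences is always 0; both vanish exactly
    at equality.\<close>
  have "computable k (\<lambda>xs. 1 - ((f xs - g xs) + (g xs - f xs)))"
    by (intro computable_diff computable_add computable_const assms)
  then show ?thesis unfolding decidable_def by (rule computable_cong) auto
qed

lemma decidable_less:
  assumes "computable k f" "computable k g" shows "decidable k (\<lambda>xs. f xs < g xs)"
proof -
  have "computable k (\<lambda>xs. 1 - (Suc (f xs) - g xs))"
    by (intro computable_diff computable_Suc computable_const assms)
  then show ?thesis unfolding decidable_def by (rule computable_cong) auto
qed

lemma decidable_not: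
  assumes "decidable k P" shows "decidable k (\<lambda>xs. \<not> P xs)"
proof -
  have "computable k (\<lambda>xs. 1 - of_bool (P xs))"
    by (intro computable_diff computable_const computable_of_bool assms)
  then show ?thesis unfolding decidable_def by (rule computable_cong) auto
qed

lemma decidable_conj:
  assumes "decidable k P" "decidable k Q" shows "decidable k (\<lambda>xs. P xs \<and> Q xs)"
proof -
  have "computable k (\<lambda>xs. of_bool (P xs) * of_bool (Q xs))"
    by (intro computable_mult computable_of_bool assms)
  then show ?thesis unfolding decidable_def by (rule computable_cong) auto
qed

lemma decidable_disj:
  assumes "decidable k P" "decidable k Q" shows "decidable k (\<lambda>xs. P xs \<or> Q xs)"
  using decidable_not[OF decidable_conj[OF decidable_not[OF assms(1)] decidable_not[OF assms(2)]]]
  by simp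

lemma decidable_imp:
  assumes "decidable k P" "decidable k Q" shows "decidable k (\<lambda>xs. P xs \<longrightarrow> Q xs)"
  using decidable_disj[OF decidable_not[OF assms(1)] assms(2)] by simp

lemma decidable_ball:
  assumes n: "computable k n" and P: "decidable (Suc k) (\<lambda>ys. P (ys ! 0) (tl ys))"
  shows "decidable k (\<lambda>xs. \<forall>i < n xs. P i xs)"
proof -
  \<comment> \<open>The recursion below passes the running product in front of the counter; shifting
    all projections by one discards it before \<open>P\<close> is evaluated.\<close>
  have "computable (length (map (\<lambda>i xs. xs ! Suc i) [0..<Suc k])) (\<lambda>ys. of_bool (P (ys ! 0) (tl ys)))"
    using P by (simp add: decidable_def)
  then have "computable (Suc (Suc k))
     (\<lambda>xs. (\<lambda>ys. of_bool (P (ys ! 0) (tl ys))) (map (\<lambda>g. g xs) (map (\<lambda>i xs. xs ! Suc i) [0..<Suc k])))"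
    by (rule computable_compose) (auto intro: computable_nth)
  then have "computable (Suc (Suc k)) (\<lambda>ys. of_bool (P (ys ! 1) (tl (tl ys))))"
  proof (rule computable_cong)
    fix xs :: "nat list" assume "length xs = Suc (Suc k)"
    then have "map (\<lambda>g. g xs) (map (\<lambda>i xs. xs ! Suc i) [0..<Suc k]) = tl xs"
      by (intro nth_equalityI) (auto simp: nth_tl simp del: upt_Suc)
    then show "(\<lambda>ys. of_bool (P (ys ! 0) (tl ys))) (map (\<lambda>g. g xs) (map (\<lambda>i xs. xs ! Suc i) [0..<Suc k]))
      = (of_bool (P (xs ! 1) (tl (tl xs))) :: nat)" using \<open>length xs = _\<close> by (simp only:) (simp add: nth_tl)
  qed
  then have "computable k (\<lambda>xs. rec_nat 1 (\<lambda>i y. y * of_bool (P i xs)) (n xs))"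
    by (intro computable_rec computable_mult computable_nth n computable_const) auto
  moreover have "rec_nat 1 (\<lambda>i y. y * of_bool (Q i)) b = (of_bool (\<forall>i<b. Q i) :: nat)" for Q b
    by (induction b) (auto simp: less_Suc_eq)
  ultimately show ?thesis unfolding decidable_def by simp
qed

lemma decidable_bex:
  assumes n: "computable k n" and P: "decidable (Suc k) (\<lambda>ys. P (ys ! 0) (tl ys))"
  shows "decidable k (\<lambda>xs. \<exists>i < n xs. P i xs)"
  using decidable_not[OF decidable_ball[OF n decidable_not[OF P]]] by simp

section \<open>Determinism, unbounded search and c.e. sets\<close>

inductive_cases evalr_ZeroE: "evalr Zero xs y"
inductive_cases evalr_SuccE: "evalr Succ xs y"
inductive_cases evalr_ProjE: "evalr (Proj i) xs y"
inductive_cases evalr_CompE: "evalr (Comp f gs) xs y"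
inductive_cases evalr_Prim0E: "evalr (Prim g h) (0 # xs) y"
inductive_cases evalr_PrimSE: "evalr (Prim g h) (Suc n # xs) y"
inductive_cases evalr_MuE: "evalr (Mu f) xs y"

text \<open>Programs are given by a relation, so this is what allows an observed value to be
  identified with the intended one. For minimisation, the smaller of two different results would be
  both a zero and a positive argument of the searched function.\<close>

lemma evalr_deterministic: "evalr f xs y \<Longrightarrow> evalr f xs z \<Longrightarrow> y = z"
proof (induction arbitrary: z rule: evalr.induct)
  case (evalr_comp xs gs ys f v)
  from evalr_comp.prems obtain ys' where
    ys': "list_all2 (\<lambda>g y. evalr g xs y) gs ys'" and v: "evalr f ys' z"
    by (elim evalr_CompE) auto
  have "ys = ys'"
    using evalr_comp.IH(1) ys' by (auto simp: list_all2_conv_all_nth intro: nth_equalityI)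
  then show ?case using evalr_comp.IH(2) v by simp
next
  case (evalr_prim0 g xs y h)
  from evalr_prim0.prems have "evalr g xs z" by (elim evalr_Prim0E)
  then show ?case using evalr_prim0.IH by blast
next
  case (evalr_primS g h n xs y v)
  from evalr_primS.prems obtain y' where "evalr (Prim g h) (n # xs) y'" "evalr h (y' # n # xs) z"
    by (elim evalr_PrimSE) auto
  then show ?case using evalr_primS.IH by blast
next
  case (evalr_mu f n xs)
  from evalr_mu.prems have z: "evalr f (z # xs) 0" "\<forall>m<z. \<exists>y>0. evalr f (m # xs) y"
    by (auto elim: evalr_MuE)
  have "\<not> z < n" using z(1) evalr_mu.IH(2) by (metis less_irrefl)
  moreover have "\<not> n < z" using z(2) evalr_mu.IH(1) by (metis less_irrefl)
  ultimately show ?case by simp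
qed (auto elim: evalr_ZeroE evalr_SuccE evalr_ProjE)

lemma computable_Least:
  assumes P: "decidable (Suc k) (\<lambda>ys. P (ys ! 0) (tl ys))"
    and ex: "\<And>xs. length xs = k \<Longrightarrow> \<exists>n. P n xs"
  shows "computable k (\<lambda>xs. LEAST n. P n xs)"
proof -
  \<comment> \<open>\<open>Mu\<close> looks for a zero, so the searched function is the truth value
    of the negation. It is total, hence defined and positive below the least witness.\<close>
  obtain r where r: "\<And>ys. length ys = Suc k \<Longrightarrow> evalr r ys (of_bool (\<not> P (ys ! 0) (tl ys)))"
    using decidable_not[OF P] unfolding decidable_def computable_def by blast
  have "evalr (Mu r) xs (LEAST n. P n xs)" if xs: "length xs = k" for xs
  proof (rule evalr_mu)
    have "P (LEAST n. P n xs) xs" using ex[OF xs] by (metis LeastI)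
    then show "evalr r ((LEAST n. P n xs) # xs) 0"
      using r[of "(LEAST n. P n xs) # xs"] xs by simp
    show "\<forall>m<LEAST n. P n xs. \<exists>y>0. evalr r (m # xs) y"
    proof (intro allI impI)
      fix m assume "m < (LEAST n. P n xs)"
      then have "\<not> P m xs" by (rule not_less_Least)
      then show "\<exists>y>0. evalr r (m # xs) y" using r[of "m # xs"] xs by force
    qed
  qed
  then show ?thesis unfolding computable_def by blast
qed

text \<open>Run an unbounded search on a function that ignores the search variable: it halts at once
  if \<open>P n\<close> holds and never otherwise, so a decision becomes a domain of
  convergence.\<close>

lemma decidable_imp_ce:
  assumes "decidable 1 (\<lambda>xs. P (xs ! 0))"
  shows "ce {n. P n}"
proof -
  have "decidable 2 (\<lambda>ys. \<not> P (ys ! 1))"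
    using computable_compose1[of "\<lambda>n. of_bool (P n)" 2 "\<lambda>ys. ys ! 1"] assms computable_nth[of 1 2]
    by (intro decidable_not) (simp add: decidable_def)
  then obtain r where r: "\<And>ys. length ys = 2 \<Longrightarrow> evalr r ys (of_bool (\<not> P (ys ! 1)))"
    unfolding decidable_def computable_def by blast
  have "P n \<longleftrightarrow> (\<exists>y. evalr (Mu r) [n] y)" for n
  proof
    assume "P n"
    then have "evalr (Mu r) [n] 0" using r[of "[0, n]"] by (intro evalr_mu) auto
    then show "\<exists>y. evalr (Mu r) [n] y" ..
  next
    assume "\<exists>y. evalr (Mu r) [n] y"
    then obtain y where "evalr r [y, n] 0" by (auto elim: evalr_MuE)
    then have "of_bool (\<not> P n) = (0::nat)" using r[of "[y, n]"] evalr_deterministic by force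
    then show "P n" by simp
  qed
  then show ?thesis unfolding ce_def by auto
qed

section \<open>Pairing and binary codes of finite sets\<close>

lemma Least_unique_witness:
  "(\<And>n. P n \<Longrightarrow> n = m) \<Longrightarrow> P m \<Longrightarrow> (LEAST n. P n) = (m::nat)"
  using LeastI[of P m] by blast

lemma computable_prod_encode:
  assumes "computable k f" "computable k g"
  shows "computable k (\<lambda>xs. prod_encode (f xs, g xs))"
proof -
  \<comment> \<open>Cantor pairing sends (m, n) to the triangular number of m + n, plus m; the
    recursion accumulates triangular numbers.\<close>
  have "computable k (\<lambda>xs. rec_nat 0 (\<lambda>i y. y + Suc i) (f xs + g xs) + f xs)"
    by (intro computable_rec computable_add computable_zero computable_Suc computable_nth assms) auto
  moreover have "rec_nat 0 (\<lambda>i y. y + Suc i) b = triangle b" for b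
    by (induction b) auto
  ultimately show ?thesis by (simp add: prod_encode_def)
qed

abbreviation pfst :: "nat \<Rightarrow> nat" where "pfst n \<equiv> fst (prod_decode n)"
abbreviation psnd :: "nat \<Rightarrow> nat" where "psnd n \<equiv> snd (prod_decode n)"

lemma psnd_le: "psnd n \<le> n"
  by (metis le_prod_encode_2 prod.collapse prod_decode_inverse)

text \<open>Unpairing is done by search. A component never exceeds the code of its pair, so the
  other component is found below a bound and the searched condition stays decidable.\<close>

lemma computable_pfst:
  assumes "computable k f" shows "computable k (\<lambda>xs. pfst (f xs))"
proof (rule computable_compose1[OF _ assms])
  have ex: "\<exists>b < Suc n. prod_encode (pfst n, b) = n" for n
    by (rule exI[of _ "psnd n"]) (simp add: psnd_le less_Suc_eq_le)
  have "computable 1 (\<lambda>xs. LEAST a. \<exists>b < Suc (xs ! 0). prod_encode (a, b) = xs ! 0)"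
    by (intro computable_Least decidable_bex decidable_eq computable_prod_encode computable_Suc
          computable_nth computable_tl) (simp, simp, simp, simp, use ex in blast)
  moreover have "(LEAST a. \<exists>b < Suc n. prod_encode (a, b) = n) = pfst n" for n
    by (rule Least_unique_witness) (use ex in auto)
  ultimately show "computable 1 (\<lambda>xs. pfst (xs ! 0))" by simp
qed

lemma computable_psnd:
  assumes "computable k f" shows "computable k (\<lambda>xs. psnd (f xs))"
proof (rule computable_compose1[OF _ assms])
  have ex: "prod_encode (pfst n, psnd n) = n" for n by simp
  have "computable 1 (\<lambda>xs. LEAST b. prod_encode (pfst (xs ! 0), b) = xs ! 0)"
    by (intro computable_Least decidable_eq computable_prod_encode computable_nth computable_tl
          computable_pfst) (use ex in blast)+
  moreover have "(LEAST b. prod_encode (pfst n, b) = n) = psnd n" for n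
    by (rule Least_unique_witness) (metis prod_encode_inverse snd_conv, simp)
  ultimately show "computable 1 (\<lambda>xs. psnd (xs ! 0))" by simp
qed

text \<open>The quotient is the least \<open>q\<close> whose successor times the power exceeds the
  dividend, so a search finds it. Such shifts are what reading one bit of a set code
  requires.\<close>

lemma computable_div_power2:
  assumes "computable k f" "computable k g" shows "computable k (\<lambda>xs. f xs div 2 ^ g xs)"
proof (rule computable_compose2[OF _ assms])
  have least: "m < Suc (m div 2 ^ n) * 2 ^ n" for m n :: nat
    by (simp add: dividend_less_div_times)
  have "computable 2 (\<lambda>xs. LEAST q. xs ! 0 < Suc q * 2 ^ (xs ! 1))"
    by (intro computable_Least decidable_less computable_mult computable_Suc computable_power2
          computable_nth computable_tl) (simp, simp, simp, use least in blast)
  moreover have "(LEAST q. m < Suc q * 2 ^ n) = m div 2 ^ n" for m n :: nat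
  proof (rule Least_equality)
    show "m < Suc (m div 2 ^ n) * 2 ^ n" by (rule least)
    show "m div 2 ^ n \<le> q" if "m < Suc q * 2 ^ n" for q
      using that by (simp add: less_mult_imp_div_less flip: less_Suc_eq_le)
  qed
  ultimately show "computable 2 (\<lambda>xs. xs ! 0 div 2 ^ (xs ! 1))" by simp
qed

lemma computable_half: "computable k f \<Longrightarrow> computable k (\<lambda>xs. f xs div 2)"
  using computable_div_power2[OF _ computable_const[of k 1]] by simp

lemma decidable_even:
  assumes "computable k f" shows "decidable k (\<lambda>xs. even (f xs))"
proof -
  have "decidable k (\<lambda>xs. 2 * (f xs div 2) = f xs)"
    by (intro decidable_eq computable_mult computable_const computable_half assms)
  moreover have "2 * (n div 2) = n \<longleftrightarrow> even n" for n :: nat by presburger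
  ultimately show ?thesis by simp
qed

lemma decidable_set_decode:
  assumes "computable k f" "computable k g"
  shows "decidable k (\<lambda>xs. g xs \<in> set_decode (f xs))"
  using decidable_not[OF decidable_even[OF computable_div_power2[OF assms]]]
  by (simp add: set_decode_def)

lemmas computability_intros =
  computable_nth computable_Suc computable_const computable_add computable_mult
  computable_of_bool computable_prod_encode computable_pfst computable_psnd computable_half
  decidable_eq decidable_less decidable_not decidable_conj decidable_disj decidable_imp
  decidable_ball decidable_bex decidable_even decidable_set_decode

section \<open>Coded rational vector spaces\<close>

text \<open>All vectors live in one ambient function space, so that the space over a smaller index
  set is literally a subset of the space over a larger one.\<close>

definition supported :: "nat set \<Rightarrow> (nat \<Rightarrow> rat) set" where
  "supported S = {w. \<forall>i. i \<notin> S \<longrightarrow> w i = 0}"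

definition elems :: "nat set \<Rightarrow> (rat + (nat \<Rightarrow> rat)) set" where
  "elems S = range Inl \<union> Inr ` supported S"

text \<open>The nine relations on uncoded tuples, arranged by the sorts of the arguments instead of
  by symbol: one case split on the shape of a tuple settles every symbol.\<close>

fun vsat :: "nat \<Rightarrow> (rat + (nat \<Rightarrow> rat)) list \<Rightarrow> bool" where
  "vsat i [Inr v] \<longleftrightarrow> i = 0 \<or> i = 6 \<and> v = (\<lambda>_. 0)"
| "vsat i [Inl q] \<longleftrightarrow> i = 1 \<or> i = 2 \<and> q = 0 \<or> i = 3 \<and> q = 1"
| "vsat i [Inl p, Inl q, Inl r] \<longleftrightarrow> i = 4 \<and> p + q = r \<or> i = 5 \<and> p * q = r"
| "vsat i [Inr u, Inr v, Inr w] \<longleftrightarrow> i = 7 \<and> (\<lambda>j. u j + v j) = w"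
| "vsat i [Inl a, Inr v, Inr w] \<longleftrightarrow> i = 8 \<and> (\<lambda>j. a * v j) = w"
| "vsat i _ \<longleftrightarrow> False"

text \<open>The space of vectors supported in \<open>S\<close>, with its elements renamed by \<open>c\<close>. Every space that occurs,
  including \<open>std_vs n\<close>, is of this form.\<close>

definition vspace :: "(rat + (nat \<Rightarrow> rat) \<Rightarrow> nat) \<Rightarrow> nat set \<Rightarrow> struc" where
  "vspace c S = (c ` elems S, \<lambda>i. {map c xs | xs. set xs \<subseteq> elems S \<and> vsat i xs})"

lemma Inl_elems [simp]: "Inl q \<in> elems S"
  and Inr_elems [simp]: "Inr w \<in> elems S \<longleftrightarrow> w \<in> supported S"
  by (auto simp: elems_def)

lemma zero_supported [simp]: "(\<lambda>_. 0) \<in> supported S"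
  by (simp add: supported_def)

lemma add_supported: "u \<in> supported S \<Longrightarrow> v \<in> supported S \<Longrightarrow> (\<lambda>j. u j + v j) \<in> supported S"
  by (simp add: supported_def)

lemma scale_supported: "v \<in> supported S \<Longrightarrow> (\<lambda>j. a * v j) \<in> supported S"
  by (simp add: supported_def)

lemma supported_mono: "S \<subseteq> T \<Longrightarrow> supported S \<subseteq> supported T"
  by (auto simp: supported_def)

lemma elems_mono: "S \<subseteq> T \<Longrightarrow> elems S \<subseteq> elems T"
  unfolding elems_def by (intro Un_mono image_mono order_refl supported_mono)

lemma vsat_arity: "vsat i xs \<Longrightarrow> i < length fvs_sig \<and> length xs = fvs_sig ! i"
  by (cases "(i, xs)" rule: vsat.cases) (auto simp: fvs_sig_def)

text \<open>Injectivity excludes a second tuple that satisfies the relation and has the same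
  codes.\<close>

lemma map_mem_vspace_iff:
  assumes "inj_on c (elems S)" "set xs \<subseteq> elems S"
  shows "map c xs \<in> snd (vspace c S) i \<longleftrightarrow> vsat i xs"
proof -
  have "xs = ys" if "map c xs = map c ys" "set ys \<subseteq> elems S" for ys
    using that assms by (metis inj_on_Un_image_eq_iff inj_on_map_eq_map le_sup_iff inj_on_subset)
  then show ?thesis using assms by (auto simp: vspace_def)
qed

lemma is_struc_vspace: "is_struc fvs_sig (vspace c S)"
  using vsat_arity by (fastforce simp: is_struc_def vspace_def)

lemma list_over_image:
  assumes "set ys \<subseteq> c ` X" obtains xs where "set xs \<subseteq> X" "ys = map c xs"
  using assms by (metis image_subset_iff in_lists_conv_set lists_image subset_code(1) imageE)

text \<open>The relations are equations, and a linear map could only turn a false one into a true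
  one. Injectivity prevents this, and it is asked only where the two sides can lie: at 0, the given
  vectors, their sums and multiples. So \<open>G\<close> may be finite and \<open>h\<close> a proper
  projection.\<close>

lemma vsat_map_sum:
  assumes add: "\<And>u v. h (\<lambda>j. u j + v j) = (\<lambda>j. h u j + h v j)"
    and scale: "\<And>a v. h (\<lambda>j. a * v j) = (\<lambda>j. a * h v j)"
    and inj: "inj_on h G" and zero: "(\<lambda>_. 0) \<in> G"
    and X: "\<And>v. Inr v \<in> X \<Longrightarrow> v \<in> G"
      "\<And>u v. Inr u \<in> X \<Longrightarrow> Inr v \<in> X \<Longrightarrow> (\<lambda>j. u j + v j) \<in> G"
      "\<And>a v. Inl a \<in> X \<Longrightarrow> Inr v \<in> X \<Longrightarrow> (\<lambda>j. a * v j) \<in> G"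
    and xs: "set xs \<subseteq> X"
  shows "vsat i (map (map_sum id h) xs) \<longleftrightarrow> vsat i xs"
proof -
  have h0: "h (\<lambda>_. 0) = (\<lambda>_. 0)" using scale[of 0 "\<lambda>_. 0"] by simp
  have "h v = (\<lambda>_. 0) \<longleftrightarrow> v = (\<lambda>_. 0)" if "Inr v \<in> X" for v
    using inj_on_eq_iff[OF inj X(1)[OF that] zero] h0 by simp
  moreover have "(\<lambda>j. h u j + h v j) = h w \<longleftrightarrow> (\<lambda>j. u j + v j) = w"
    if "Inr u \<in> X" "Inr v \<in> X" "Inr w \<in> X" for u v w
    using inj_on_eq_iff[OF inj X(2)[OF that(1,2)] X(1)[OF that(3)]] add by simp
  moreover have "(\<lambda>j. a * h v j) = h w \<longleftrightarrow> (\<lambda>j. a * v j) = w"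
    if "Inl a \<in> X" "Inr v \<in> X" "Inr w \<in> X" for a v w
    using inj_on_eq_iff[OF inj X(3)[OF that(1,2)] X(1)[OF that(3)]] scale by simp
  ultimately show ?thesis
    using xs by (cases "(i, xs)" rule: vsat.cases) auto
qed

lemma iso_vspaceI:
  assumes c: "inj_on c (elems S)" and d: "inj_on d (elems T)"
    and k: "bij_betw k (elems S) (elems T)"
    and vsat: "\<And>i xs. set xs \<subseteq> elems S \<Longrightarrow> vsat i (map k xs) \<longleftrightarrow> vsat i xs"
  shows "iso fvs_sig (vspace c S) (vspace d T)"
  unfolding iso_def
proof (intro exI[of _ "d \<circ> k \<circ> inv_into (elems S) c"] conjI allI impI)
  have "bij_betw (inv_into (elems S) c) (c ` elems S) (elems S)"
    using c by (simp add: bij_betw_inv_into inj_on_imp_bij_betw)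
  moreover have "bij_betw d (elems T) (d ` elems T)"
    using d by (rule inj_on_imp_bij_betw)
  ultimately show "bij_betw (d \<circ> k \<circ> inv_into (elems S) c) (fst (vspace c S)) (fst (vspace d T))"
    using k by (auto simp: vspace_def intro!: bij_betw_trans)
next
  fix i ys
  assume "length ys = fvs_sig ! i \<and> set ys \<subseteq> fst (vspace c S)"
  then obtain xs where xs: "set xs \<subseteq> elems S" "ys = map c xs"
    by (auto simp: vspace_def elim: list_over_image)
  have "map (d \<circ> k \<circ> inv_into (elems S) c) ys = map d (map k xs)"
    using xs c by (auto simp: subset_iff)
  moreover have "set (map k xs) \<subseteq> elems T"
    using xs(1) k by (auto simp: bij_betw_def)
  ultimately show "ys \<in> snd (vspace c S) i \<longleftrightarrow>
      map (d \<circ> k \<circ> inv_into (elems S) c) ys \<in> snd (vspace d T) i"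
    using map_mem_vspace_iff[OF c xs(1)] map_mem_vspace_iff[OF d, of "map k xs" i] vsat[OF xs(1)] xs(2)
    by metis
qed

text \<open>A bijection between the index sets relabels coordinates. It is taken from
  \<open>T\<close> to \<open>S\<close> because functions pull back.\<close>

lemma iso_vspace_same_card:
  assumes c: "inj_on c (elems S)" and d: "inj_on d (elems T)"
    and fin: "finite S" "finite T" "card S = card T"
  shows "iso fvs_sig (vspace c S) (vspace d T)"
proof -
  obtain s where s: "bij_betw s T S"
    using fin finite_same_card_bij by metis
  define h :: "(nat \<Rightarrow> rat) \<Rightarrow> nat \<Rightarrow> rat" where "h w = (\<lambda>j. if j \<in> T then w (s j) else 0)" for w
  define g :: "(nat \<Rightarrow> rat) \<Rightarrow> nat \<Rightarrow> rat" where
    "g w = (\<lambda>i. if i \<in> S then w (inv_into T s i) else 0)" for w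
  have "g (h w) = w" if "w \<in> supported S" for w
    using that s bij_betw_inv_into_right[OF s] bij_betw_apply[OF bij_betw_inv_into[OF s]]
    by (auto simp: g_def h_def supported_def)
  moreover have "h (g w) = w" if "w \<in> supported T" for w
    using that s bij_betw_inv_into_left[OF s] bij_betw_apply[OF s]
    by (auto simp: g_def h_def supported_def)
  ultimately have h: "bij_betw h (supported S) (supported T)"
    by (intro bij_betw_byWitness[where f' = g]) (auto simp: g_def h_def supported_def)
  have k: "bij_betw (map_sum id h) (elems S) (elems T)"
  proof -
    have hi: "inj_on h (supported S)" and hs: "h ` supported S = supported T"
      using h by (simp_all only: bij_betw_def)
    have "inj_on (map_sum id h) (elems S)"
    proof (rule inj_onI)
      fix x y assume "x \<in> elems S" "y \<in> elems S" "map_sum id h x = map_sum id h y"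
      then show "x = y" using inj_onD[OF hi] by (cases x; cases y) auto
    qed
    moreover have "map_sum id h ` elems S = elems T"
      by (simp add: elems_def image_Un image_image flip: hs)
    ultimately show ?thesis by (simp add: bij_betw_def)
  qed
  show ?thesis
    by (rule iso_vspaceI[OF c d k], rule vsat_map_sum[where G = "supported S"])
       (use h in \<open>auto simp: h_def[abs_def] bij_betw_def add_supported scale_supported\<close>)
qed

section \<open>The standard spaces as coded spaces\<close>

definition std_code :: "nat \<Rightarrow> rat + (nat \<Rightarrow> rat) \<Rightarrow> nat" where
  "std_code n x = enc (map_sum id (\<lambda>w. map w [0..<n]) x)"

lemma enc_eq_iff [simp]: "enc x = enc y \<longleftrightarrow> x = y"
  by (simp add: enc_def)

lemma inj_std_code: "inj_on (std_code n) (elems {..<n})"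
proof (rule inj_onI)
  have *: "u = v" if "u \<in> supported {..<n}" "v \<in> supported {..<n}" "map u [0..<n] = map v [0..<n]" for u v
  proof
    fix i show "u i = v i" using that by (cases "i < n") (auto simp: supported_def)
  qed
  fix x y assume "x \<in> elems {..<n}" "y \<in> elems {..<n}" "std_code n x = std_code n y"
  then show "x = y" using * by (cases x; cases y) (auto simp: std_code_def)
qed

lemma list_as_supported:
  assumes "length v = n" obtains w where "w \<in> supported {..<n}" "v = map w [0..<n]"
proof
  show "(\<lambda>i. if i < n then v ! i else 0) \<in> supported {..<n}" by (simp add: supported_def)
  show "v = map (\<lambda>i. if i < n then v ! i else 0) [0..<n]"
    using assms by (intro nth_equalityI) auto
qed

text \<open>An equality and not merely an isomorphism, so that facts about \<open>vspace\<close>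
  apply directly to the spaces defining \<open>FVS\<close>. A vector supported below
  \<open>n\<close> amounts to the list of its first \<open>n\<close> values.\<close>

lemma std_vs_eq: "std_vs n = vspace (std_code n) {..<n}"
proof (rule prod_eqI)
  have "v \<in> (\<lambda>w. map w [0..<n]) ` supported {..<n}" if "length v = n" for v
    using list_as_supported[OF that] by blast
  then have "{v. length v = n} = (\<lambda>w. map w [0..<n]) ` supported {..<n}" by auto
  then show "fst (std_vs n) = fst (vspace (std_code n) {..<n})"
    by (simp add: std_vs_def vspace_def elems_def image_Un image_image std_code_def)
  show "snd (std_vs n) = snd (vspace (std_code n) {..<n})"
  proof (rule ext, rule set_eqI, rule iffI)
    fix i ys assume "ys \<in> snd (vspace (std_code n) {..<n}) i"
    then obtain xs where xs: "set xs \<subseteq> elems {..<n}" "vsat i xs" "ys = map (std_code n) xs"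
      by (auto simp: vspace_def)
    show "ys \<in> snd (std_vs n) i"
      using xs by (cases "(i, xs)" rule: vsat.cases)
        (auto simp: std_vs_def std_code_def map_replicate_const map2_map_map o_def
          intro!: exI[of _ "map _ [0..<n]"])
  next
    fix i ys assume ys: "ys \<in> snd (std_vs n) i"
    have "\<exists>xs. ys = map (std_code n) xs \<and> set xs \<subseteq> elems {..<n} \<and> vsat i xs"
    proof -
      have "i \<in> {0, 1, 2, 3, 4, 5, 6, 7, 8}" using ys by (auto simp: std_vs_def split: if_splits)
      then consider "i = 0" | "i = 1" | "i = 2" | "i = 3" | "i = 4" | "i = 5" | "i = 6" | "i = 7" | "i = 8"
        by blast
      then show ?thesis
      proof cases
        case 1
        with ys obtain v where "length v = n" "ys = [enc (Inr v)]" by (auto simp: std_vs_def)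
        then show ?thesis using 1
          by (elim list_as_supported) (auto simp: std_code_def intro!: exI[of _ "[Inr _]"])
      next
        case 2
        with ys obtain q where "ys = [enc (Inl q)]" by (auto simp: std_vs_def)
        then show ?thesis using 2 by (intro exI[of _ "[Inl q]"]) (simp add: std_code_def)
      next
        case 3
        with ys show ?thesis by (intro exI[of _ "[Inl 0]"]) (simp add: std_code_def std_vs_def)
      next
        case 4
        with ys show ?thesis by (intro exI[of _ "[Inl 1]"]) (simp add: std_code_def std_vs_def)
      next
        case 5
        with ys obtain p q where "ys = [enc (Inl p), enc (Inl q), enc (Inl (p + q))]"
          by (auto simp: std_vs_def)
        then show ?thesis using 5
          by (intro exI[of _ "[Inl p, Inl q, Inl (p + q)]"]) (simp add: std_code_def)
      next
        case 6
        with ys obtain p q where "ys = [enc (Inl p), enc (Inl q), enc (Inl (p * q))]"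
          by (auto simp: std_vs_def)
        then show ?thesis using 6
          by (intro exI[of _ "[Inl p, Inl q, Inl (p * q)]"]) (simp add: std_code_def)
      next
        case 7
        with ys show ?thesis
          by (intro exI[of _ "[Inr (\<lambda>_. 0)]"]) (simp add: std_code_def std_vs_def map_replicate_const)
      next
        case 8
        with ys obtain u v where "length u = n" "length v = n"
          "ys = [enc (Inr u), enc (Inr v), enc (Inr (map2 (+) u v))]"
          by (auto simp: std_vs_def)
        moreover from this obtain u' v' where "u' \<in> supported {..<n}" "u = map u' [0..<n]"
          "v' \<in> supported {..<n}" "v = map v' [0..<n]"
          by (metis list_as_supported)
        ultimately show ?thesis using 8
          by (intro exI[of _ "[Inr u', Inr v', Inr (\<lambda>j. u' j + v' j)]"])
             (simp add: std_code_def add_supported map2_map_map)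
      next
        case 9
        with ys obtain a v where "length v = n"
          "ys = [enc (Inl a), enc (Inr v), enc (Inr (map ((*) a) v))]"
          by (auto simp: std_vs_def)
        moreover from this obtain v' where "v' \<in> supported {..<n}" "v = map v' [0..<n]"
          by (metis list_as_supported)
        ultimately show ?thesis using 9
          by (intro exI[of _ "[Inl a, Inr v', Inr (\<lambda>j. a * v' j)]"])
             (simp add: std_code_def scale_supported)
      qed
    qed
    then show "ys \<in> snd (vspace (std_code n) {..<n}) i" by (auto simp: vspace_def)
  qed
qed

lemma vspace_in_FVS:
  assumes "finite S" "inj_on c (elems S)" shows "vspace c S \<in> FVS"
  using iso_vspace_same_card[OF assms(2) inj_std_code[of "card S"] assms(1)] is_struc_vspace
  by (auto simp: FVS_def std_vs_eq)

section \<open>Invariance of dimension\<close>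

text \<open>A homogeneous system with more unknowns than equations has a nonzero solution, by
  Gaussian elimination: each induction step removes one equation and one unknown.\<close>

lemma linear_dependence:
  fixes v :: "'a \<Rightarrow> nat \<Rightarrow> rat"
  assumes "finite S" "finite T" "card S < card T"
  shows "\<exists>c. (\<exists>t\<in>T. c t \<noteq> 0) \<and> (\<forall>s\<in>S. (\<Sum>t\<in>T. c t * v t s) = 0)"
  using assms
proof (induction S arbitrary: T v rule: finite_induct)
  case empty
  then obtain t where "t \<in> T" by fastforce
  then show ?case by (intro exI[of _ "\<lambda>_. 1"]) auto
next
  case (insert s S)
  show ?case
  proof (cases "\<forall>t\<in>T. v t s = 0")
    case True
    obtain c where "\<exists>t\<in>T. c t \<noteq> 0" "\<forall>s\<in>S. (\<Sum>t\<in>T. c t * v t s) = 0"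
      using insert.IH[of T v] insert.prems insert.hyps by auto
    then show ?thesis using True by (intro exI[of _ c]) auto
  next
    case False
    \<comment> \<open>The pivot: equation \<open>s\<close> serves to eliminate the unknown indexed
      by \<open>p\<close> from the others.\<close>
    then obtain p where p: "p \<in> T" "v p s \<noteq> 0" by auto
    have "card S < card (T - {p})" using insert.prems insert.hyps p(1) by simp
    then obtain c where c: "\<exists>t\<in>T - {p}. c t \<noteq> 0"
      "\<forall>i\<in>S. (\<Sum>t\<in>T - {p}. c t * (v t i - v t s / v p s * v p i)) = 0"
      using insert.IH[of "T - {p}" "\<lambda>t i. v t i - v t s / v p s * v p i"] insert.prems by auto
    \<comment> \<open>The value of the eliminated unknown forced by equation \<open>s\<close>. In
      the other equations it restores exactly the multiples of the pivot row that elimination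
      subtracted.\<close>
    define r where "r = - (\<Sum>t\<in>T - {p}. c t * v t s) / v p s"
    have sum: "(\<Sum>t\<in>T. (c(p := r)) t * v t i) = r * v p i + (\<Sum>t\<in>T - {p}. c t * v t i)" for i
      using insert.prems(1) p(1) by (simp add: sum.remove)
    have "(\<Sum>t\<in>T. (c(p := r)) t * v t i) = 0" if "i \<in> insert s S" for i
    proof (cases "i = s")
      case True
      then show ?thesis unfolding sum using p(2) by (simp add: r_def)
    next
      case False
      with that have "0 = (\<Sum>t\<in>T - {p}. c t * (v t i - v t s / v p s * v p i))"
        using c(2) by auto
      also have "\<dots> = (\<Sum>t\<in>T - {p}. c t * v t i) - (\<Sum>t\<in>T - {p}. c t * v t s) / v p s * v p i"
        by (simp add: sum_subtractf right_diff_distrib sum_distrib_right sum_divide_distrib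
            mult.assoc)
      finally show ?thesis unfolding sum by (simp add: r_def)
    qed
    then show ?thesis using c(1) by (intro exI[of _ "c(p := r)"]) auto
  qed
qed

text \<open>Over the rationals additivity forces homogeneity: for naturals by repeated addition, for
  integers by inverses, for fractions by clearing the denominator. An isomorphism can thus be
  studied through vector addition alone.\<close>

lemma additive_homogeneous:
  assumes h: "\<And>u v. u \<in> supported T \<Longrightarrow> v \<in> supported T \<Longrightarrow> h (\<lambda>j. u j + v j) = (\<lambda>j. h u j + h v j)"
    and w: "w \<in> supported T"
  shows "h (\<lambda>j. (a::rat) * w j) = (\<lambda>j. (a::rat) * (h w :: nat \<Rightarrow> rat) j)"
proof -
  have zero: "h (\<lambda>_. 0) = (\<lambda>_. 0)"
    using h[of "\<lambda>_. 0" "\<lambda>_. 0"] by (auto simp: fun_eq_iff)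
  have nat: "h (\<lambda>j. of_nat n * u j) = (\<lambda>j. of_nat n * h u j)" if u: "u \<in> supported T" for n u
  proof (induction n)
    case 0
    then show ?case by (simp add: zero)
  next
    case (Suc n)
    show ?case
      using h[OF u scale_supported[OF u, of "of_nat n"]] Suc by (simp add: distrib_right)
  qed
  have int: "h (\<lambda>j. of_int m * u j) = (\<lambda>j. of_int m * h u j)" if u: "u \<in> supported T" for m u
  proof (cases m rule: int_cases2)
    case (nonneg n)
    then show ?thesis using nat[OF u] by simp
  next
    case (nonpos n)
    have "(\<lambda>j. h (\<lambda>j. of_nat n * u j) j + h (\<lambda>j. - of_nat n * u j) j) = (\<lambda>_. 0)"
      using h[OF scale_supported[OF u, of "of_nat n"] scale_supported[OF u, of "- of_nat n"]] zero
      by simp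
    then show ?thesis using nonpos nat[OF u, of n] by (auto simp: fun_eq_iff add_eq_0_iff)
  qed
  obtain m n where a: "a = of_int m / of_int n" and n: "n > 0"
    using quotient_of_div[of a] quotient_of_denom_pos[of a] by (cases "quotient_of a") auto
  have "(\<lambda>j. of_int n * h (\<lambda>j. a * w j) j) = h (\<lambda>j. of_int n * (a * w j))"
    using int[OF scale_supported[OF w]] by simp
  also have "\<dots> = (\<lambda>j. of_int m * h w j)"
    using int[OF w, of m] a n by simp
  finally have "h (\<lambda>j. a * w j) j = of_int m * h w j / of_int n" for j
    using n by (simp add: fun_eq_iff nonzero_eq_divide_eq mult.commute)
  then show ?thesis by (simp add: a fun_eq_iff)
qed

text \<open>Otherwise the images of the unit vectors would be linearly dependent, and injectivity
  would pull the dependence back to the unit vectors.\<close>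

lemma additive_injective_card_le:
  assumes h: "\<And>u v. u \<in> supported T \<Longrightarrow> v \<in> supported T \<Longrightarrow> h (\<lambda>j. u j + v j) = (\<lambda>j. h u j + h v j)"
    and inj: "inj_on h (supported T)" and ran: "h ` supported T \<subseteq> supported S"
    and fin: "finite S" "finite T"
  shows "card T \<le> card S"
proof (rule ccontr)
  assume "\<not> card T \<le> card S"
  define e :: "nat \<Rightarrow> nat \<Rightarrow> rat" where "e t = (\<lambda>j. if j = t then 1 else 0)" for t
  have e: "e t \<in> supported T" if "t \<in> T" for t
    using that by (auto simp: e_def supported_def)
  obtain c where c: "\<exists>t\<in>T. c t \<noteq> 0" "\<forall>s\<in>S. (\<Sum>t\<in>T. c t * h (e t) s) = 0"
    using linear_dependence[of S T "\<lambda>t. h (e t)"] fin \<open>\<not> card T \<le> card S\<close> by auto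
  have zero: "h (\<lambda>_. 0) = (\<lambda>_. 0)"
    using h[of "\<lambda>_. 0" "\<lambda>_. 0"] by (auto simp: fun_eq_iff)
  \<comment> \<open>Additivity is available only on \<open>supported T\<close>, so membership of the
    partial sums is carried through the induction.\<close>
  have comb: "h (\<lambda>j. \<Sum>t\<in>F. c t * e t j) = (\<lambda>j. \<Sum>t\<in>F. c t * h (e t) j)
      \<and> (\<lambda>j. \<Sum>t\<in>F. c t * e t j) \<in> supported T" if "F \<subseteq> T" for F
    using finite_subset[OF that fin(2)] that
  proof (induction F rule: finite_induct)
    case empty
    then show ?case by (simp add: zero)
  next
    case (insert t F)
    have ct: "(\<lambda>j. c t * e t j) \<in> supported T" using insert.prems e scale_supported by blast
    have F: "h (\<lambda>j. \<Sum>t\<in>F. c t * e t j) = (\<lambda>j. \<Sum>t\<in>F. c t * h (e t) j)"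
      "(\<lambda>j. \<Sum>t\<in>F. c t * e t j) \<in> supported T" using insert by blast+
    have "h (\<lambda>j. c t * e t j) = (\<lambda>j. c t * h (e t) j)"
      by (rule additive_homogeneous[OF h e]) (use insert.prems in auto)
    then show ?case
      using h[OF ct F(2)] add_supported[OF ct F(2)] F(1) insert.hyps by simp
  qed
  \<comment> \<open>The dependence was obtained for coordinates in \<open>S\<close>; all other
    coordinates of the images are 0.\<close>
  have "(\<Sum>t\<in>T. c t * h (e t) j) = 0" for j
  proof (cases "j \<in> S")
    case True
    then show ?thesis using c(2) by blast
  next
    case False
    then have "h (e t) j = 0" if "t \<in> T" for t
      using ran e[OF that] by (auto simp: supported_def)
    then show ?thesis by simp
  qed
  then have "h (\<lambda>j. \<Sum>t\<in>T. c t * e t j) = h (\<lambda>_. 0)"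
    using comb[of T] zero by simp
  then have "(\<lambda>j. \<Sum>t\<in>T. c t * e t j) = (\<lambda>_. 0)"
    using inj_onD[OF inj] comb[of T] zero_supported by blast
  moreover have "(\<Sum>t\<in>T. c t * e t j) = c j" if "j \<in> T" for j
    using that fin(2) by (simp add: e_def if_distrib[of "(*) _"] cong: if_cong)
  ultimately show False using c(1) by (metis (no_types, lifting))
qed

lemma iso_sym: assumes "iso L A B" shows "iso L B A"
proof -
  obtain f where f: "bij_betw f (fst A) (fst B)"
    and rel: "\<And>i xs. i < length L \<Longrightarrow> length xs = L ! i \<Longrightarrow> set xs \<subseteq> fst A \<Longrightarrow>
        xs \<in> snd A i \<longleftrightarrow> map f xs \<in> snd B i"
    using assms unfolding iso_def by blast
  let ?g = "inv_into (fst A) f"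
  have g: "bij_betw ?g (fst B) (fst A)" using f by (rule bij_betw_inv_into)
  moreover have "ys \<in> snd B i \<longleftrightarrow> map ?g ys \<in> snd A i"
    if "i < length L" "length ys = L ! i" "set ys \<subseteq> fst B" for i ys
  proof -
    have "set (map ?g ys) \<subseteq> fst A" using that(3) g by (auto simp: bij_betw_def)
    moreover have "map f (map ?g ys) = ys"
      using that(3) bij_betw_inv_into_right[OF f] by (auto simp: subset_iff intro: map_idI)
    ultimately show ?thesis using rel[of i "map ?g ys"] that by simp
  qed
  ultimately show ?thesis unfolding iso_def by blast
qed

text \<open>The vector predicate (symbol 0) makes vectors go to vectors, and the graph of vector
  addition (symbol 7) makes the induced map additive; its injectivity bounds the dimension.\<close>

lemma iso_vspace_card_le:
  assumes iso: "iso fvs_sig (vspace c T) (vspace d S)"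
    and c: "inj_on c (elems T)" and d: "inj_on d (elems S)" and fin: "finite S" "finite T"
  shows "card T \<le> card S"
proof -
  obtain f where f: "bij_betw f (c ` elems T) (d ` elems S)"
    and rel: "\<And>i xs. i < 9 \<Longrightarrow> length xs = fvs_sig ! i \<Longrightarrow> set xs \<subseteq> elems T \<Longrightarrow>
        vsat i xs \<longleftrightarrow> map f (map c xs) \<in> snd (vspace d S) i"
  proof -
    from iso obtain f where f: "bij_betw f (c ` elems T) (d ` elems S)"
      and rel: "\<And>i xs. i < 9 \<Longrightarrow> length xs = fvs_sig ! i \<Longrightarrow> set xs \<subseteq> c ` elems T \<Longrightarrow>
        xs \<in> snd (vspace c T) i \<longleftrightarrow> map f xs \<in> snd (vspace d S) i"
      unfolding iso_def by (auto simp: vspace_def fvs_sig_def)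
    have "vsat i xs \<longleftrightarrow> map f (map c xs) \<in> snd (vspace d S) i"
      if "i < 9" "length xs = fvs_sig ! i" "set xs \<subseteq> elems T" for i xs
      using rel[of i "map c xs"] that map_mem_vspace_iff[OF c that(3)] by auto
    then show thesis using f that by blast
  qed
  have vec: "\<exists>v\<in>supported S. f (c (Inr w)) = d (Inr v)" if "w \<in> supported T" for w
  proof -
    have "[f (c (Inr w))] \<in> snd (vspace d S) 0"
      using rel[of 0 "[Inr w]"] that by (simp add: fvs_sig_def)
    then obtain x where "x \<in> elems S" "vsat 0 [x]" "f (c (Inr w)) = d x"
      by (auto simp: vspace_def)
    then show ?thesis by (cases x) auto
  qed
  define h where "h w = (SOME v. v \<in> supported S \<and> f (c (Inr w)) = d (Inr v))" for w
  have h: "h w \<in> supported S" "f (c (Inr w)) = d (Inr (h w))" if "w \<in> supported T" for w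
    using someI_ex[of "\<lambda>v. v \<in> supported S \<and> f (c (Inr w)) = d (Inr v)"] vec[OF that]
    unfolding h_def by blast+
  show ?thesis
  proof (rule additive_injective_card_le[where h = h, OF _ _ _ fin])
    show "h ` supported T \<subseteq> supported S" using h by blast
    show "inj_on h (supported T)"
    proof (rule inj_onI)
      fix u v assume uv: "u \<in> supported T" "v \<in> supported T" "h u = h v"
      then have "f (c (Inr u)) = f (c (Inr v))" using h by simp
      then have "c (Inr u) = c (Inr v)" using uv f by (auto simp: bij_betw_def dest: inj_onD)
      then show "u = v" using uv c by (auto dest: inj_onD)
    qed
    fix u v assume uv: "u \<in> supported T" "v \<in> supported T"
    define w where "w = (\<lambda>j. u j + v j)"
    have w: "w \<in> supported T" unfolding w_def using uv by (rule add_supported)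
    have "map f (map c [Inr u, Inr v, Inr w]) \<in> snd (vspace d S) 7"
      using rel[of 7 "[Inr u, Inr v, Inr w]"] uv w by (simp add: fvs_sig_def w_def)
    then have "map d [Inr (h u), Inr (h v), Inr (h w)] \<in> snd (vspace d S) 7"
      using h uv w by simp
    then have "vsat 7 [Inr (h u), Inr (h v), Inr (h w)]"
      using map_mem_vspace_iff[OF d, of "[Inr (h u), Inr (h v), Inr (h w)]" 7] h uv w by simp
    then show "h (\<lambda>j. u j + v j) = (\<lambda>j. h u j + h v j)" by (simp add: w_def)
  qed
qed

lemma iso_vspace_iff:
  assumes "inj_on c (elems S)" "inj_on d (elems T)" "finite S" "finite T"
  shows "iso fvs_sig (vspace c S) (vspace d T) \<longleftrightarrow> card S = card T"
proof
  assume i: "iso fvs_sig (vspace c S) (vspace d T)"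
  show "card S = card T"
    using iso_vspace_card_le[OF i] iso_vspace_card_le[OF iso_sym[OF i]] assms by (simp add: le_antisym)
qed (use iso_vspace_same_card assms in blast)

section \<open>Classification of finite linear orders\<close>

text \<open>Counting the elements at or below a point maps a finite order isomorphically onto an
  initial interval of the positive integers. The isomorphism goes up one such rank function and down
  the other.\<close>

lemma FLO_iso_same_card:
  assumes A: "A \<in> FLO" and B: "B \<in> FLO" and card: "card (fst A) = card (fst B)"
  shows "iso flo_sig A B"
proof -
  define rk where "rk C a = card {b \<in> fst C. [b, a] \<in> snd C 0}" for C :: struc and a
  have rk: "bij_betw (rk C) (fst C) {1..card (fst C)}
      \<and> (\<forall>a\<in>fst C. \<forall>b\<in>fst C. [a, b] \<in> snd C 0 \<longleftrightarrow> rk C a \<le> rk C b)" if C: "C \<in> FLO" for C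
  proof -
    have fin: "finite (fst C)" using C by (simp add: FLO_def)
    have ord: "\<And>a. a \<in> fst C \<Longrightarrow> [a, a] \<in> snd C 0"
      "\<And>a b. a \<in> fst C \<Longrightarrow> b \<in> fst C \<Longrightarrow> [a, b] \<in> snd C 0 \<Longrightarrow> [b, a] \<in> snd C 0 \<Longrightarrow> a = b"
      "\<And>a b d. a \<in> fst C \<Longrightarrow> b \<in> fst C \<Longrightarrow> d \<in> fst C \<Longrightarrow> [a, b] \<in> snd C 0 \<Longrightarrow> [b, d] \<in> snd C 0 \<Longrightarrow> [a, d] \<in> snd C 0"
      "\<And>a b. a \<in> fst C \<Longrightarrow> b \<in> fst C \<Longrightarrow> [a, b] \<in> snd C 0 \<or> [b, a] \<in> snd C 0"
      using C unfolding FLO_def Let_def by blast+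
    have le: "rk C a \<le> rk C b" if "a \<in> fst C" "b \<in> fst C" "[a, b] \<in> snd C 0" for a b
      unfolding rk_def
    proof (rule card_mono)
      show "{x \<in> fst C. [x, a] \<in> snd C 0} \<subseteq> {x \<in> fst C. [x, b] \<in> snd C 0}"
        using that ord(3) by blast
    qed (simp add: fin)
    have less: "rk C b < rk C a" if ab: "a \<in> fst C" "b \<in> fst C" "[a, b] \<notin> snd C 0" for a b
    proof -
      have "[b, a] \<in> snd C 0" using ab ord(4) by blast
      then have "{x \<in> fst C. [x, b] \<in> snd C 0} \<subset> {x \<in> fst C. [x, a] \<in> snd C 0}"
        using ab ord(1,3) by blast
      then show ?thesis unfolding rk_def using fin by (intro psubset_card_mono) auto
    qed
    have iff: "[a, b] \<in> snd C 0 \<longleftrightarrow> rk C a \<le> rk C b" if "a \<in> fst C" "b \<in> fst C" for a b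
      using le less that by (meson not_le)
    have inj: "inj_on (rk C) (fst C)"
      using iff ord(2) by (intro inj_onI) simp
    have "rk C a \<in> {1..card (fst C)}" if "a \<in> fst C" for a
    proof -
      \<comment> \<open>The element itself is counted, so ranks start at 1.\<close>
      have "{b \<in> fst C. [b, a] \<in> snd C 0} \<noteq> {}" using that ord(1) by blast
      then show ?thesis unfolding rk_def using fin by (auto simp: Suc_le_eq card_gt_0_iff intro: card_mono)
    qed
    then have "rk C ` fst C = {1..card (fst C)}"
      by (intro card_subset_eq) (auto simp: card_image[OF inj])
    then show ?thesis using inj iff by (simp add: bij_betw_def)
  qed
  let ?f = "inv_into (fst B) (rk B) \<circ> rk A"
  have bA: "bij_betw (rk A) (fst A) {1..card (fst A)}" and bB: "bij_betw (rk B) (fst B) {1..card (fst B)}"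
    using rk A B by auto
  have f: "bij_betw ?f (fst A) (fst B)"
    using bA bij_betw_inv_into[OF bB] card by (auto intro: bij_betw_trans)
  have rkf: "rk B (?f a) = rk A a" if "a \<in> fst A" for a
    using bij_betw_inv_into_right[OF bB, of "rk A a"] bij_betwE[OF bA] that card by simp
  have "xs \<in> snd A i \<longleftrightarrow> map ?f xs \<in> snd B i"
    if xs: "i < length flo_sig" "length xs = flo_sig ! i" "set xs \<subseteq> fst A" for i xs
  proof -
    obtain a b where [simp]: "i = 0" "xs = [a, b]"
      using xs(1,2) by (auto simp: flo_sig_def length_Suc_conv numeral_2_eq_2)
    have ab: "a \<in> fst A" "b \<in> fst A" using xs(3) by auto
    then have "?f a \<in> fst B" "?f b \<in> fst B" using bij_betwE[OF f] by blast+
    then have "[?f a, ?f b] \<in> snd B 0 \<longleftrightarrow> rk A a \<le> rk A b"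
      using rk[OF B] rkf ab by metis
    then show ?thesis using rk[OF A] ab by simp
  qed
  then show ?thesis unfolding iso_def using f by blast
qed

section \<open>Finite parts of diagrams of vector spaces\<close>

fun constants :: "atom \<Rightarrow> nat set" where
  "constants (Eq a b) = {a, b}"
| "constants (Rel i xs) = set xs"

text \<open>A literal sees only the elements it names, so \<open>k\<close> has to behave well on
  \<open>X\<close> alone. Since \<open>k\<close> preserves codes there, the very same literal, and
  not a renamed copy, lies in the second diagram.\<close>

lemma diag_vspace_transfer:
  assumes c: "inj_on c (elems S)" and d: "inj_on d (elems T)"
    and X: "X \<subseteq> elems S" and k: "k ` X \<subseteq> elems T" and dk: "\<And>x. x \<in> X \<Longrightarrow> d (k x) = c x"
    and vsat: "\<And>i xs. set xs \<subseteq> X \<Longrightarrow> vsat i (map k xs) \<longleftrightarrow> vsat i xs"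
    and l: "l \<in> diag fvs_sig (vspace c S)" "constants (snd l) \<subseteq> c ` X"
  shows "l \<in> diag fvs_sig (vspace d T)"
proof -
  obtain a where a: "a \<in> atoms fvs_sig (fst (vspace c S))" "l = (holds (vspace c S) a, a)"
    using l(1) by (auto simp: diag_def)
  have cX: "c ` X \<subseteq> fst (vspace d T)"
    using k dk by (force simp: vspace_def)
  have "a \<in> atoms fvs_sig (fst (vspace d T)) \<and> holds (vspace d T) a = holds (vspace c S) a"
  proof (cases a)
    case (Eq x y)
    then show ?thesis using a l(2) cX by (auto simp: atoms_def)
  next
    case (Rel i ys)
    then have ys: "set ys \<subseteq> c ` X" "i < length fvs_sig" "length ys = fvs_sig ! i"
      using a l(2) by (auto simp: atoms_def)
    obtain xs where xs: "set xs \<subseteq> X" "ys = map c xs" using ys(1) by (rule list_over_image)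
    have "ys = map d (map k xs)" using xs dk by (auto simp: subset_iff)
    moreover have "set (map k xs) \<subseteq> elems T" using xs(1) k by auto
    ultimately have "ys \<in> snd (vspace d T) i \<longleftrightarrow> vsat i xs"
      using map_mem_vspace_iff[OF d] vsat[OF xs(1)] by metis
    moreover have "ys \<in> snd (vspace c S) i \<longleftrightarrow> vsat i xs"
      using map_mem_vspace_iff[OF c] xs X by blast
    ultimately show ?thesis using Rel ys cX by (auto simp: atoms_def)
  qed
  then show ?thesis using a by (auto simp: diag_def)
qed

lemma constants_diag: "l \<in> diag L A \<Longrightarrow> constants (snd l) \<subseteq> fst A"
  by (auto simp: diag_def atoms_def)

lemma finite_constants: "finite (constants a)"
  by (cases a) auto

lemma diag_vspace_mono:
  assumes "inj_on c (elems T)" "S \<subseteq> T"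
  shows "diag fvs_sig (vspace c S) \<subseteq> diag fvs_sig (vspace c T)"
proof
  fix l assume l: "l \<in> diag fvs_sig (vspace c S)"
  show "l \<in> diag fvs_sig (vspace c T)"
    by (rule diag_vspace_transfer[where X = "elems S" and k = id, OF inj_on_subset[OF assms(1)] assms(1) _ _ _ _ l])
       (use elems_mono[OF assms(2)] constants_diag[OF l] in \<open>auto simp: vspace_def\<close>)
qed

text \<open>Keeping scalars even and vectors odd allows the codes of vectors to be changed independently of
  those of scalars.\<close>

fun parity_code :: "(rat \<Rightarrow> nat) \<Rightarrow> ((nat \<Rightarrow> rat) \<Rightarrow> nat) \<Rightarrow> rat + (nat \<Rightarrow> rat) \<Rightarrow> nat" where
  "parity_code r e (Inl q) = 2 * r q"
| "parity_code r e (Inr w) = 2 * e w + 1"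

lemma inj_parity_code:
  assumes "inj r" "inj_on e (supported S)" shows "inj_on (parity_code r e) (elems S)"
proof (rule inj_onI)
  fix x y assume "x \<in> elems S" "y \<in> elems S" "parity_code r e x = parity_code r e y"
  moreover have "2 * m \<noteq> 2 * n + 1" "2 * n + 1 \<noteq> 2 * m" for m n :: nat by presburger+
  ultimately show "x = y"
    by (cases x; cases y) (auto dest: injD[OF assms(1)] inj_onD[OF assms(2)])
qed

text \<open>Two distinct vectors of the plane are identified by the projection for at most one slope
  \<open>t\<close>. Finitely many pairs exclude finitely many slopes, and there are infinitely many
  rationals.\<close>

lemma generic_projection:
  fixes G :: "(nat \<Rightarrow> rat) set"
  assumes "finite G" "G \<subseteq> supported {0, 1}"
  obtains t :: rat where "inj_on (\<lambda>w (j::nat). if j = 0 then w 0 + t * w 1 else 0) G"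
proof -
  define bad where "bad p = {t. fst p \<noteq> snd p \<and> fst p 0 + t * fst p 1 = snd p 0 + t * snd p 1}"
    for p :: "(nat \<Rightarrow> rat) \<times> (nat \<Rightarrow> rat)"
  have "finite (bad p)" if "p \<in> G \<times> G" for p
  proof -
    obtain u v where p: "p = (u, v)" by fastforce
    have "t = (v 0 - u 0) / (u 1 - v 1)" if t: "t \<in> bad p" for t
    proof -
      \<comment> \<open>With equal second coordinates the projections agree only if the first
        coordinates do too, which makes the vectors equal.\<close>
      have "u 1 \<noteq> v 1"
      proof
        assume "u 1 = v 1"
        moreover have "u 0 + t * u 1 = v 0 + t * v 1" "u \<noteq> v" using t p by (simp_all add: bad_def)
        moreover have "u \<in> supported {0, 1}" "v \<in> supported {0, 1}"
          using \<open>p \<in> G \<times> G\<close> assms(2) p by auto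
        ultimately have "u j = v j" for j
          by (cases "j \<in> {0, 1}") (auto simp: supported_def)
        then show False using \<open>u \<noteq> v\<close> by blast
      qed
      moreover have "t * (u 1 - v 1) = v 0 - u 0"
        using t p by (simp add: bad_def algebra_simps)
      ultimately show ?thesis by (simp add: eq_divide_eq)
    qed
    then have "bad p \<subseteq> {(v 0 - u 0) / (u 1 - v 1)}" by blast
    then show ?thesis by (rule finite_subset) simp
  qed
  then have "finite (\<Union>p \<in> G \<times> G. bad p)" using assms(1) by blast
  then obtain t where "t \<notin> (\<Union>p \<in> G \<times> G. bad p)"
    using ex_new_if_finite infinite_UNIV_char_0 by metis
  then have t: "u = v" if "u \<in> G" "v \<in> G" "u 0 + t * u 1 = v 0 + t * v 1" for u v
    using that by (auto simp: bad_def)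
  show thesis
  proof (rule that, rule inj_onI)
    fix u v :: "nat \<Rightarrow> rat" assume "u \<in> G" "v \<in> G"
      "(\<lambda>j::nat. if j = 0 then u 0 + t * u 1 else 0) = (\<lambda>j. if j = 0 then v 0 + t * v 1 else 0)"
    then show "u = v" using t[of u v] by (auto dest: fun_cong[where x = 0])
  qed
qed

text \<open>Finitely many literals name finitely many elements. A generic projection respects all
  relations among these, and the line is then recoded so that projected vectors inherit the codes of
  the originals.\<close>

lemma finite_diagram_in_line:
  assumes r: "inj r" and e: "inj_on e (supported {0, 1})" and fin: "finite \<alpha>"
    and \<alpha>: "\<alpha> \<subseteq> diag fvs_sig (vspace (parity_code r e) {0, 1})"
  shows "\<exists>e'. inj_on e' (supported {0}) \<and> \<alpha> \<subseteq> diag fvs_sig (vspace (parity_code r e') {0})"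
proof -
  let ?c = "parity_code r e"
  have c: "inj_on ?c (elems {0, 1})" using r e by (rule inj_parity_code)
  define E where "E = (\<Union>l \<in> \<alpha>. constants (snd l))"
  define X where "X = {x \<in> elems {0, 1}. ?c x \<in> E}"
  have "finite E" unfolding E_def using fin finite_constants by blast
  moreover have "?c ` X \<subseteq> E" "inj_on ?c X" using inj_on_subset[OF c] by (auto simp: X_def)
  ultimately have finX: "finite X" by (metis finite_imageD finite_subset)
  have EX: "E \<subseteq> ?c ` X"
  proof -
    have "E \<subseteq> fst (vspace ?c {0, 1})" unfolding E_def using \<alpha> constants_diag by blast
    then show ?thesis by (auto simp: X_def vspace_def)
  qed
  define G0 where "G0 = Inr -` X"
  define R where "R = Inl -` X"
  have fin0: "finite G0" "finite R"
    unfolding G0_def R_def using finX by (auto intro: finite_vimageI)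
  have G0: "G0 \<subseteq> supported {0, 1}" by (auto simp: G0_def X_def)
  \<comment> \<open>Everything that can occur as a side of a relation between named elements; the
    projection has to be injective here, not only on the named vectors.\<close>
  define G where "G = insert (\<lambda>_. 0) (G0 \<union> (\<lambda>(u, v) j. u j + v j) ` (G0 \<times> G0)
      \<union> (\<lambda>(a, v) j. a * v j) ` (R \<times> G0))"
  have "finite G" unfolding G_def using fin0 by simp
  moreover have "G \<subseteq> supported {0, 1}"
    using G0 add_supported scale_supported by (auto simp: G_def subset_iff)
  ultimately obtain t where t: "inj_on (\<lambda>w (j::nat). if j = 0 then w 0 + t * w 1 else 0) G"
    by (rule generic_projection)
  define h :: "(nat \<Rightarrow> rat) \<Rightarrow> nat \<Rightarrow> rat" where "h w = (\<lambda>j. if j = 0 then w 0 + t * w 1 else 0)" for w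
  have hG: "inj_on h G" using t by (simp add: h_def[abs_def])
  then have hG0: "inj_on h G0" by (rule inj_on_subset) (auto simp: G_def)
  have hs: "h w \<in> supported {0}" for w by (simp add: h_def supported_def)
  \<comment> \<open>\<open>N\<close> lies above all inherited codes, so the remaining vectors of the
    line can keep their old codes shifted by \<open>N\<close> without a collision.\<close>
  obtain N where N: "\<And>w. w \<in> G0 \<Longrightarrow> e w < N"
    using fin0(1) finite_nat_set_iff_bounded[of "e ` G0"] by auto
  define e' where "e' u = (if u \<in> h ` G0 then e (inv_into G0 h u) else N + e u)" for u
  have e'h: "e' (h w) = e w" if "w \<in> G0" for w
    using that hG0 by (simp add: e'_def)
  have e': "inj_on e' (supported {0})"
  proof (rule inj_onI)
    fix u v assume uv: "u \<in> supported {0}" "v \<in> supported {0}" "e' u = e' v"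
    have sub: "supported {0} \<subseteq> supported {0, 1}" by (rule supported_mono) simp
    consider "u \<in> h ` G0" "v \<in> h ` G0" | "u \<in> h ` G0" "v \<notin> h ` G0"
      | "u \<notin> h ` G0" "v \<in> h ` G0" | "u \<notin> h ` G0" "v \<notin> h ` G0" by blast
    then show "u = v"
    proof cases
      case 1
      then obtain u' v' where "u' \<in> G0" "v' \<in> G0" "u = h u'" "v = h v'" by blast
      then show ?thesis using uv(3) e'h inj_onD[OF e] G0 by auto
    next
      case 2
      then obtain u' where "u' \<in> G0" "u = h u'" by blast
      then have "e' u < N" using e'h N by simp
      moreover have "e' v \<ge> N" using 2 by (simp add: e'_def)
      ultimately show ?thesis using uv(3) by simp
    next
      case 3
      then obtain v' where "v' \<in> G0" "v = h v'" by blast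
      then have "e' v < N" using e'h N by simp
      moreover have "e' u \<ge> N" using 3 by (simp add: e'_def)
      ultimately show ?thesis using uv(3) by simp
    next
      case 4
      then have "e u = e v" using uv(3) by (simp add: e'_def)
      then show ?thesis using uv sub inj_onD[OF e] by blast
    qed
  qed
  have d: "inj_on (parity_code r e') (elems {0})" using r e' by (rule inj_parity_code)
  have k: "map_sum id h x \<in> elems {0} \<and> parity_code r e' (map_sum id h x) = ?c x" if "x \<in> X" for x
    using that hs e'h by (cases x) (auto simp: G0_def)
  have vsat: "vsat i (map (map_sum id h) xs) \<longleftrightarrow> vsat i xs" if xs: "set xs \<subseteq> X" for i xs
  proof (rule vsat_map_sum[OF _ _ hG _ _ _ _ xs])
    show "h (\<lambda>j. u j + v j) = (\<lambda>j. h u j + h v j)" for u v by (auto simp: h_def algebra_simps)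
    show "h (\<lambda>j. a * v j) = (\<lambda>j. a * h v j)" for a v by (auto simp: h_def algebra_simps)
    show "(\<lambda>_. 0) \<in> G" by (simp add: G_def)
    show "v \<in> G" if "Inr v \<in> X" for v using that by (simp add: G_def G0_def)
    show "(\<lambda>j. u j + v j) \<in> G" if "Inr u \<in> X" "Inr v \<in> X" for u v
      using that by (force simp: G_def G0_def)
    show "(\<lambda>j. a * v j) \<in> G" if "Inl a \<in> X" "Inr v \<in> X" for a v
      using that by (force simp: G_def G0_def R_def)
  qed
  have "l \<in> diag fvs_sig (vspace (parity_code r e') {0})" if "l \<in> \<alpha>" for l
  proof (rule diag_vspace_transfer[where k = "map_sum id h" and X = X, OF c d _ _ _ vsat])
    show "constants (snd l) \<subseteq> ?c ` X" using that EX by (auto simp: E_def)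
  qed (use that \<alpha> k in \<open>auto simp: X_def\<close>)
  then show ?thesis using e' by blast
qed

text \<open>Universes can be read off from positive literals, so an inclusion of diagrams gives an
  inclusion of universes.\<close>

lemma fst_eq_diag: "fst B = {b. (True, Eq b b) \<in> diag L B}"
  by (auto simp: diag_def atoms_def)

section \<open>Vector spaces do not embed into finite orders\<close>

lemma FVS_not_le_FLO: "\<not> le_c fvs_sig FVS flo_sig FLO"
proof
  assume "le_c fvs_sig FVS flo_sig FLO"
  then obtain \<Phi> where \<Phi>: "comp_emb fvs_sig FVS flo_sig FLO \<Phi>" by (auto simp: le_c_def)
  then have trans: "\<And>A. A \<in> FVS \<Longrightarrow> \<exists>B \<in> FLO. apply_trans fvs_sig \<Phi> A = diag flo_sig B"
    and fin\<Phi>: "\<And>\<alpha> \<phi>. (\<alpha>, \<phi>) \<in> \<Phi> \<Longrightarrow> finite \<alpha>"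
    by (auto simp: comp_emb_def comp_trans_def)
  have emb: "iso fvs_sig A A' \<longleftrightarrow> iso flo_sig B B'"
    if "A \<in> FVS" "A' \<in> FVS" "B \<in> FLO" "B' \<in> FLO"
      "apply_trans fvs_sig \<Phi> A = diag flo_sig B" "apply_trans fvs_sig \<Phi> A' = diag flo_sig B'" for A A' B B'
    using \<Phi> that unfolding comp_emb_def FLO_def by blast
  have finFLO: "finite (fst B)" if "B \<in> FLO" for B using that by (simp add: FLO_def)
  define r :: "rat \<Rightarrow> nat" where "r = to_nat"
  define e :: "(nat \<Rightarrow> rat) \<Rightarrow> nat" where "e w = to_nat (w 0, w 1)" for w
  have r: "inj r" by (simp add: r_def)
  have e: "inj_on e (supported {0, 1})"
  proof (rule inj_onI, rule ext)
    fix u v j assume "u \<in> supported {0, 1}" "v \<in> supported {0, 1}" "e u = e v"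
    then show "u j = v j" by (cases "j \<in> {0, 1}") (auto simp: e_def supported_def)
  qed
  let ?c = "parity_code r e"
  have c2: "inj_on ?c (elems {0, 1})" using r e by (rule inj_parity_code)
  have c1: "inj_on ?c (elems {0})" using c2 by (rule inj_on_subset) (simp add: elems_mono)
  let ?A1 = "vspace ?c {0}" and ?A2 = "vspace ?c {0, 1}"
  have A1: "?A1 \<in> FVS" and A2: "?A2 \<in> FVS" using c1 c2 by (auto intro: vspace_in_FVS)
  obtain B1 B2 where B1: "B1 \<in> FLO" "apply_trans fvs_sig \<Phi> ?A1 = diag flo_sig B1"
    and B2: "B2 \<in> FLO" "apply_trans fvs_sig \<Phi> ?A2 = diag flo_sig B2"
    using trans A1 A2 by metis
  \<comment> \<open>\<Phi> only tests whether premises are included in the input, so a larger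
    diagram yields a larger output.\<close>
  have "diag fvs_sig ?A1 \<subseteq> diag fvs_sig ?A2" using c2 by (rule diag_vspace_mono) simp
  then have "diag flo_sig B1 \<subseteq> diag flo_sig B2"
    unfolding B1(2)[symmetric] B2(2)[symmetric] apply_trans_def by blast
  then have "fst B1 \<subseteq> fst B2" using fst_eq_diag[of _ flo_sig] by blast
  then have le: "card (fst B1) \<le> card (fst B2)" using finFLO[OF B2(1)] by (rule card_mono[rotated])
  \<comment> \<open>Each element of \<open>B2\<close> is announced by a pair of \<Phi> with finitely
    many premises. As \<open>B2\<close> is finite, choosing one pair per element keeps the total of
    premises finite.\<close>
  have "\<forall>b\<in>fst B2. \<exists>\<alpha>. \<alpha> \<subseteq> diag fvs_sig ?A2 \<and> (\<alpha>, (True, Eq b b)) \<in> \<Phi>"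
    using B2(2) fst_eq_diag[of B2 flo_sig] unfolding apply_trans_def by blast
  then obtain f where f: "\<And>b. b \<in> fst B2 \<Longrightarrow> f b \<subseteq> diag fvs_sig ?A2 \<and> (f b, (True, Eq b b)) \<in> \<Phi>"
    by metis
  have "finite (\<Union>b\<in>fst B2. f b)" "(\<Union>b\<in>fst B2. f b) \<subseteq> diag fvs_sig ?A2"
    using f fin\<Phi> finFLO[OF B2(1)] by blast+
  from finite_diagram_in_line[OF r e this] obtain e' where e': "inj_on e' (supported {0})"
    and sub: "(\<Union>b\<in>fst B2. f b) \<subseteq> diag fvs_sig (vspace (parity_code r e') {0})" by blast
  have c3: "inj_on (parity_code r e') (elems {0})" using r e' by (rule inj_parity_code)
  let ?A3 = "vspace (parity_code r e') {0}"
  have A3: "?A3 \<in> FVS" using c3 by (auto intro: vspace_in_FVS)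
  obtain B3 where B3: "B3 \<in> FLO" "apply_trans fvs_sig \<Phi> ?A3 = diag flo_sig B3"
    using trans A3 by metis
  \<comment> \<open>The chosen pairs also fire on the recoded line, so its output contains every
    element of \<open>B2\<close>.\<close>
  have "(True, Eq b b) \<in> diag flo_sig B3" if "b \<in> fst B2" for b
    unfolding B3(2)[symmetric] apply_trans_def using f[OF that] sub that by blast
  then have "fst B2 \<subseteq> fst B3" using fst_eq_diag[of B3 flo_sig] by blast
  then have ge: "card (fst B2) \<le> card (fst B3)" using finFLO[OF B3(1)] by (rule card_mono[rotated])
  have "iso fvs_sig ?A1 ?A3" using iso_vspace_iff[OF c1 c3] by simp
  then have "iso flo_sig B1 B3" using emb A1 A3 B1 B3 by blast
  then have "card (fst B1) = card (fst B3)" unfolding iso_def by (metis bij_betw_same_card)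
  \<comment> \<open>The size of \<open>B2\<close> is squeezed between those of \<open>B1\<close> and
    \<open>B3\<close>, which are equal.\<close>
  then have "iso flo_sig B1 B2" using le ge B1 B2 FLO_iso_same_card by simp
  then have "iso fvs_sig ?A1 ?A2" using emb A1 A2 B1 B2 by blast
  then show False using iso_vspace_iff[OF c1 c2] by simp
qed

section \<open>A decidable space of finitely supported vectors\<close>

abbreviation numpos :: "nat \<Rightarrow> nat" where "numpos n \<equiv> pfst n"
abbreviation numneg :: "nat \<Rightarrow> nat" where "numneg n \<equiv> pfst (psnd n)"
abbreviation denom :: "nat \<Rightarrow> nat" where "denom n \<equiv> Suc (psnd (psnd n))"

text \<open>A rational is coded as a difference of naturals over a positive natural, so that its arithmetic
  reduces to polynomial identities in the naturals.\<close>

definition rat_of_code :: "nat \<Rightarrow> rat" where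
  "rat_of_code n = (of_nat (numpos n) - of_nat (numneg n)) / of_nat (denom n)"

lemma surj_rat_of_code: "\<exists>n. rat_of_code n = q"
proof -
  obtain a b where q: "q = of_int a / of_int b" and b: "b > 0"
    using quotient_of_div[of q] quotient_of_denom_pos[of q] by (cases "quotient_of q") auto
  \<comment> \<open>The numerator is split into its positive and negative part; \<open>denom\<close>
    adds one, hence the entry \<open>nat b - 1\<close>.\<close>
  have "rat_of_code (prod_encode (nat a, prod_encode (nat (- a), nat b - 1)))
      = (of_nat (nat a) - of_nat (nat (- a))) / of_nat (nat b)"
    using b by (simp add: rat_of_code_def)
  also have "of_nat (nat a) - of_nat (nat (- a)) = (of_int a :: rat)"
    by (cases "a \<ge> 0") auto
  also have "of_nat (nat b) = (of_int b :: rat)" using b by simp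
  finally show ?thesis using q by blast
qed

lemma rat_of_code_eq_iff:
  "rat_of_code a = rat_of_code b \<longleftrightarrow>
    numpos a * denom b + numneg b * denom a = numpos b * denom a + numneg a * denom b"
proof -
  have "rat_of_code a = rat_of_code b \<longleftrightarrow> (of_nat (numpos a) - of_nat (numneg a)) * of_nat (denom b)
      = (of_nat (numpos b) - of_nat (numneg b)) * (of_nat (denom a) :: rat)"
    unfolding rat_of_code_def by (rule frac_eq_eq) simp_all
  also have "\<dots> \<longleftrightarrow> (of_nat (numpos a * denom b + numneg b * denom a) :: rat)
      = of_nat (numpos b * denom a + numneg a * denom b)"
    unfolding of_nat_add of_nat_mult by (auto simp: algebra_simps)
  finally show ?thesis unfolding of_nat_eq_iff .
qed

text \<open>Denominators are cleared and negative terms moved across, which leaves only sums and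
  products of naturals.\<close>

lemma rat_of_code_add_iff:
  "rat_of_code a + rat_of_code b = rat_of_code c \<longleftrightarrow>
    (numpos a * denom b + numpos b * denom a) * denom c + numneg c * (denom a * denom b)
    = (numneg a * denom b + numneg b * denom a) * denom c + numpos c * (denom a * denom b)"
proof -
  have "rat_of_code a + rat_of_code b = 
     ((of_nat (numpos a) - of_nat (numneg a)) * of_nat (denom b) + (of_nat (numpos b) - of_nat (numneg b)) * of_nat (denom a))
      / (of_nat (denom a) * of_nat (denom b))"
    unfolding rat_of_code_def by (rule add_frac_eq) simp_all
  then have "rat_of_code a + rat_of_code b = rat_of_code c \<longleftrightarrow>
     ((of_nat (numpos a) - of_nat (numneg a)) * of_nat (denom b) + (of_nat (numpos b) - of_nat (numneg b)) * of_nat (denom a)) * of_nat (denom c)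
      = (of_nat (numpos c) - of_nat (numneg c)) * (of_nat (denom a) * of_nat (denom b) :: rat)"
    unfolding rat_of_code_def[of c] by (simp only:) (rule frac_eq_eq, simp_all)
  also have "\<dots> \<longleftrightarrow> (of_nat ((numpos a * denom b + numpos b * denom a) * denom c + numneg c * (denom a * denom b)) :: rat)
    = of_nat ((numneg a * denom b + numneg b * denom a) * denom c + numpos c * (denom a * denom b))"
    unfolding of_nat_add of_nat_mult by (auto simp: algebra_simps)
  finally show ?thesis unfolding of_nat_eq_iff .
qed

lemma rat_of_code_mult_iff:
  "rat_of_code a * rat_of_code b = rat_of_code c \<longleftrightarrow>
    (numpos a * numpos b + numneg a * numneg b) * denom c + numneg c * (denom a * denom b)
    = (numpos a * numneg b + numneg a * numpos b) * denom c + numpos c * (denom a * denom b)"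
proof -
  have "rat_of_code a * rat_of_code b = rat_of_code c \<longleftrightarrow>
     ((of_nat (numpos a) - of_nat (numneg a)) * (of_nat (numpos b) - of_nat (numneg b))) * of_nat (denom c)
      = (of_nat (numpos c) - of_nat (numneg c)) * (of_nat (denom a) * of_nat (denom b) :: rat)"
    unfolding rat_of_code_def times_divide_times_eq by (rule frac_eq_eq) simp_all
  also have "\<dots> \<longleftrightarrow> (of_nat ((numpos a * numpos b + numneg a * numneg b) * denom c + numneg c * (denom a * denom b)) :: rat)
    = of_nat ((numpos a * numneg b + numneg a * numpos b) * denom c + numpos c * (denom a * denom b))"
    unfolding of_nat_add of_nat_mult by (auto simp: algebra_simps)
  finally show ?thesis unfolding of_nat_eq_iff .
qed

lemma decidable_rat_eq:
  "computable k f \<Longrightarrow> computable k g \<Longrightarrow> decidable k (\<lambda>xs. rat_of_code (f xs) = rat_of_code (g xs))"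
  unfolding rat_of_code_eq_iff by (intro computability_intros)

lemma decidable_rat_add:
  "computable k f \<Longrightarrow> computable k g \<Longrightarrow> computable k h \<Longrightarrow>
    decidable k (\<lambda>xs. rat_of_code (f xs) + rat_of_code (g xs) = rat_of_code (h xs))"
  unfolding rat_of_code_add_iff by (intro computability_intros)

lemma decidable_rat_mult:
  "computable k f \<Longrightarrow> computable k g \<Longrightarrow> computable k h \<Longrightarrow>
    decidable k (\<lambda>xs. rat_of_code (f xs) * rat_of_code (g xs) = rat_of_code (h xs))"
  unfolding rat_of_code_mult_iff by (intro computability_intros)

text \<open>A vector is coded by the \<open>list_encode\<close> of codes of its coefficients; past the end of the list, and
  also at \<open>0 - 1 = 0\<close>, everything decodes to zero.\<close>

definition drop_code :: "nat \<Rightarrow> nat \<Rightarrow> nat" where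
  "drop_code n i = ((\<lambda>m. psnd (m - 1)) ^^ i) n"

definition coeff_code :: "nat \<Rightarrow> nat \<Rightarrow> nat" where
  "coeff_code n i = pfst (drop_code n i - 1)"

definition vec_of_code :: "nat \<Rightarrow> nat \<Rightarrow> rat" where
  "vec_of_code n i = rat_of_code (coeff_code n i)"

text \<open>Taking a tail lowers a nonzero code. A code therefore bounds the positions of its
  nonzero coefficients, which turns vector equations into finite checks.\<close>

lemma drop_code_le: "drop_code n i \<le> n - i"
proof (induction i)
  case (Suc i)
  have "drop_code n (Suc i) \<le> drop_code n i - 1" by (simp add: drop_code_def psnd_le)
  then show ?case using Suc by linarith
qed (simp add: drop_code_def)

lemma prod_decode_0 [simp]: "prod_decode 0 = (0, 0)"
  using prod_encode_inverse[of "(0, 0)", unfolded prod_encode_def] by simp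

lemma vec_of_code_eq_0: "i \<ge> n \<Longrightarrow> vec_of_code n i = 0"
  using drop_code_le[of n i] by (simp add: vec_of_code_def coeff_code_def rat_of_code_def)

lemma vec_of_code_0: "vec_of_code 0 = (\<lambda>_. 0)"
  by (simp add: fun_eq_iff vec_of_code_eq_0)

lemma vec_of_code_Suc:
  "vec_of_code (Suc (prod_encode (x, m))) i = (case i of 0 \<Rightarrow> rat_of_code x | Suc j \<Rightarrow> vec_of_code m j)"
  by (cases i) (simp_all add: vec_of_code_def coeff_code_def drop_code_def funpow_Suc_right del: funpow.simps(2))

lemma surj_vec_of_code:
  assumes "finite S" "w \<in> supported S" shows "\<exists>n. vec_of_code n = w"
proof -
  have "\<exists>n. vec_of_code n = w" if "\<And>i. i \<ge> N \<Longrightarrow> w i = 0" for N w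
    using that
  proof (induction N arbitrary: w)
    case 0
    then show ?case by (intro exI[of _ 0]) (simp add: vec_of_code_0 fun_eq_iff)
  next
    case (Suc N)
    obtain m where m: "vec_of_code m = (\<lambda>i. w (Suc i))" using Suc.IH[of "\<lambda>i. w (Suc i)"] Suc.prems by auto
    obtain x where x: "rat_of_code x = w 0" using surj_rat_of_code by blast
    have "vec_of_code (Suc (prod_encode (x, m))) = w"
      using m x by (auto simp: fun_eq_iff vec_of_code_Suc split: nat.split)
    then show ?case ..
  qed
  moreover obtain N where "\<And>i. i \<in> S \<Longrightarrow> i < N"
    using assms(1) finite_nat_set_iff_bounded by auto
  then have "w i = 0" if "i \<ge> N" for i
    using that assms(2) by (force simp: supported_def)
  ultimately show ?thesis by blast
qed

lemma computable_coeff_code: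
  assumes "computable k f" "computable k g" shows "computable k (\<lambda>xs. coeff_code (f xs) (g xs))"
proof -
  have "computable k (\<lambda>xs. rec_nat (f xs) (\<lambda>i y. psnd (y - 1)) (g xs))"
    by (intro computable_rec assms computable_psnd computable_diff computable_const computable_nth) simp
  moreover have "rec_nat n (\<lambda>i y. psnd (y - 1)) m = drop_code n m" for n m
    by (induction m) (simp_all add: drop_code_def)
  ultimately have "computable k (\<lambda>xs. drop_code (f xs) (g xs))" by simp
  then show ?thesis unfolding coeff_code_def
    by (intro computable_pfst computable_diff computable_const)
qed

text \<open>Applied with \<open>N\<close> a sum of vector codes, beyond which both sides vanish; the
  equation then becomes a bounded quantifier.\<close>

lemma fun_eq_iff_bounded:
  assumes "\<And>i. i \<ge> N \<Longrightarrow> u i = v i"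
  shows "u = v \<longleftrightarrow> (\<forall>i<(N::nat). u i = v i)"
proof
  assume "\<forall>i<N. u i = v i"
  then have "u i = v i" for i using assms by (cases "i < N") auto
  then show "u = v" by (rule ext)
qed simp

lemma decidable_vec_eq:
  assumes "computable k f" "computable k g"
  shows "decidable k (\<lambda>xs. vec_of_code (f xs) = vec_of_code (g xs))"
proof -
  have "decidable k (\<lambda>xs. \<forall>i<f xs + g xs. vec_of_code (f xs) i = vec_of_code (g xs) i)"
    unfolding vec_of_code_def
    by (intro decidable_ball computable_add decidable_rat_eq computable_coeff_code computable_nth
          assms assms[THEN computable_tl]) simp_all
  moreover have "vec_of_code a = vec_of_code b \<longleftrightarrow> (\<forall>i<a + b. vec_of_code a i = vec_of_code b i)" for a b
    by (rule fun_eq_iff_bounded) (simp add: vec_of_code_eq_0)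
  ultimately show ?thesis by simp
qed

lemma decidable_vec_add:
  assumes "computable k f" "computable k g" "computable k h"
  shows "decidable k (\<lambda>xs. (\<lambda>j. vec_of_code (f xs) j + vec_of_code (g xs) j) = vec_of_code (h xs))"
proof -
  have "decidable k (\<lambda>xs. \<forall>i<f xs + g xs + h xs.
      vec_of_code (f xs) i + vec_of_code (g xs) i = vec_of_code (h xs) i)"
    unfolding vec_of_code_def
    by (intro decidable_ball computable_add decidable_rat_add computable_coeff_code computable_nth
          assms assms[THEN computable_tl]) simp_all
  moreover have "(\<lambda>j. vec_of_code a j + vec_of_code b j) = vec_of_code c \<longleftrightarrow>
      (\<forall>i<a + b + c. vec_of_code a i + vec_of_code b i = vec_of_code c i)" for a b c
    by (rule fun_eq_iff_bounded) (simp add: vec_of_code_eq_0)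
  ultimately show ?thesis by simp
qed

lemma decidable_vec_scale:
  assumes "computable k f" "computable k g" "computable k h"
  shows "decidable k (\<lambda>xs. (\<lambda>j. rat_of_code (f xs) * vec_of_code (g xs) j) = vec_of_code (h xs))"
proof -
  \<comment> \<open>The code of the scalar does not enter the bound: a multiple vanishes wherever
    its vector does.\<close>
  have "decidable k (\<lambda>xs. \<forall>i<g xs + h xs.
      rat_of_code (f xs) * vec_of_code (g xs) i = vec_of_code (h xs) i)"
    unfolding vec_of_code_def
    by (intro decidable_ball computable_add decidable_rat_mult computable_coeff_code computable_nth
          assms assms[THEN computable_tl]) simp_all
  moreover have "(\<lambda>j. rat_of_code a * vec_of_code b j) = vec_of_code c \<longleftrightarrow>
      (\<forall>i<b + c. rat_of_code a * vec_of_code b i = vec_of_code c i)" for a b c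
    by (rule fun_eq_iff_bounded) (simp add: vec_of_code_eq_0)
  ultimately show ?thesis by simp
qed

text \<open>Codes are not unique; the least code of an element represents it in the structure.\<close>

definition rat_code :: "rat \<Rightarrow> nat" where "rat_code q = (LEAST n. rat_of_code n = q)"
definition vec_code :: "(nat \<Rightarrow> rat) \<Rightarrow> nat" where "vec_code w = (LEAST n. vec_of_code n = w)"

abbreviation code :: "rat + (nat \<Rightarrow> rat) \<Rightarrow> nat" where "code \<equiv> parity_code rat_code vec_code"

definition decode :: "nat \<Rightarrow> rat + (nat \<Rightarrow> rat)" where
  "decode n = (if even n then Inl (rat_of_code (n div 2)) else Inr (vec_of_code (n div 2)))"

text \<open>Being a least code is tested against the finitely many smaller numbers, so the
  representatives form a decidable set.\<close>

definition canonical :: "nat \<Rightarrow> bool" where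
  "canonical n \<longleftrightarrow> (even n \<longrightarrow> (\<forall>m<n div 2. rat_of_code m \<noteq> rat_of_code (n div 2))) \<and>
     (odd n \<longrightarrow> (\<forall>m<n div 2. vec_of_code m \<noteq> vec_of_code (n div 2)))"

lemma rat_of_code_inverse: "rat_of_code (rat_code q) = q"
  unfolding rat_code_def using surj_rat_of_code by (rule LeastI_ex)

lemma vec_of_code_inverse: "finite S \<Longrightarrow> w \<in> supported S \<Longrightarrow> vec_of_code (vec_code w) = w"
  unfolding vec_code_def using surj_vec_of_code by (metis (mono_tags) LeastI_ex)

lemma inj_code:
  assumes "finite S" shows "inj_on code (elems S)"
proof (rule inj_parity_code)
  show "inj rat_code" by (metis injI rat_of_code_inverse)
  show "inj_on vec_code (supported S)" by (metis inj_onI vec_of_code_inverse[OF assms])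
qed

lemma decode_code: "finite S \<Longrightarrow> x \<in> elems S \<Longrightarrow> decode (code x) = x"
  by (cases x) (auto simp: decode_def rat_of_code_inverse vec_of_code_inverse)

lemma canonical_code: "finite S \<Longrightarrow> x \<in> elems S \<Longrightarrow> canonical (code x)"
proof -
  have "m < rat_code q \<Longrightarrow> rat_of_code m \<noteq> q" for m q
    unfolding rat_code_def by (rule not_less_Least)
  moreover have "m < vec_code w \<Longrightarrow> vec_of_code m \<noteq> w" for m w
    unfolding vec_code_def by (rule not_less_Least)
  moreover assume "finite S" "x \<in> elems S"
  ultimately show ?thesis
    by (cases x) (auto simp: canonical_def rat_of_code_inverse vec_of_code_inverse)
qed

lemma code_decode: "canonical n \<Longrightarrow> code (decode n) = n"
proof (cases "even n")
  case True
  assume "canonical n"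
  then have "rat_code (rat_of_code (n div 2)) = n div 2"
    unfolding rat_code_def using True
    by (intro Least_equality) (auto simp: canonical_def intro: leI)
  then show ?thesis using True by (simp add: decode_def)
next
  case False
  assume "canonical n"
  then have "vec_code (vec_of_code (n div 2)) = n div 2"
    unfolding vec_code_def using False
    by (intro Least_equality) (auto simp: canonical_def intro: leI)
  then show ?thesis using False by (simp add: decode_def)
qed

lemma decidable_canonical:
  assumes f: "computable k f" shows "decidable k (\<lambda>xs. canonical (f xs))"
  unfolding canonical_def
  by (intro computability_intros decidable_rat_eq decidable_vec_eq f computable_tl[OF f]) simp_all

section \<open>Decidability of the diagrams\<close>

definition eq_code :: "nat \<Rightarrow> nat" where
  "eq_code a = lit_code (True, Eq a a)"

text \<open>Here \<open>s\<close> is the binary code of a finite set of premises, and the result is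
  the basis for which these premises vouch.\<close>

definition named :: "nat \<Rightarrow> nat set" where
  "named s = {a. eq_code a \<in> set_decode s}"

text \<open>A decidable form of membership in the coded space with basis \<open>named s\<close>.
  Nonzero coefficients occur only below the vector code, which bounds the quantifier;
  \<open>rat_of_code 0\<close> stands for zero so that equality of coded rationals applies.\<close>

definition in_universe :: "nat \<Rightarrow> nat \<Rightarrow> bool" where
  "in_universe s n \<longleftrightarrow> canonical n \<and>
     (odd n \<longrightarrow> (\<forall>i<n div 2. rat_of_code (coeff_code (n div 2) i) \<noteq> rat_of_code 0 \<longrightarrow> eq_code i \<in> set_decode s))"

lemma eq_code_eq: "eq_code a = prod_encode (1, 2 * prod_encode (a, a))"
  by (simp add: eq_code_def lit_code_def sum_encode_def)

lemma eq_code_inject [simp]: "eq_code a = eq_code b \<longleftrightarrow> a = b"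
  by (simp add: eq_code_eq)

lemma finite_named: "finite (named s)"
proof -
  have "finite (eq_code ` named s)"
    by (rule finite_subset[OF _ finite_set_decode[of s]]) (auto simp: named_def)
  then show ?thesis by (rule finite_imageD) (simp add: inj_on_def)
qed

lemma in_universe_iff: "in_universe s n \<longleftrightarrow> n \<in> code ` elems (named s)"
proof -
  have supp: "vec_of_code m \<in> supported (named s) \<longleftrightarrow>
      (\<forall>i<m. rat_of_code (coeff_code m i) \<noteq> rat_of_code 0 \<longrightarrow> eq_code i \<in> set_decode s)" for m
  proof -
    have "rat_of_code 0 = 0" by (simp add: rat_of_code_def)
    moreover have "vec_of_code m \<in> supported (named s) \<longleftrightarrow> (\<forall>i. vec_of_code m i \<noteq> 0 \<longrightarrow> eq_code i \<in> set_decode s)"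
      by (auto simp: supported_def named_def)
    moreover have "vec_of_code m i \<noteq> 0 \<Longrightarrow> i < m" for i using vec_of_code_eq_0 leI by blast
    ultimately show ?thesis unfolding vec_of_code_def by auto
  qed
  have "in_universe s n \<longleftrightarrow> canonical n \<and> decode n \<in> elems (named s)"
    unfolding in_universe_def supp[symmetric] by (auto simp: decode_def)
  moreover have "canonical n \<and> decode n \<in> elems (named s) \<longleftrightarrow> n \<in> code ` elems (named s)"
    using code_decode[of n] canonical_code[OF finite_named] decode_code[OF finite_named] by force
  ultimately show ?thesis by simp
qed

lemma decidable_in_universe:
  assumes "computable k f" "computable k g" shows "decidable k (\<lambda>xs. in_universe (f xs) (g xs))"
  unfolding in_universe_def eq_code_eq
  by (intro computability_intros decidable_rat_eq computable_coeff_code decidable_canonical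
        assms assms[THEN computable_tl]) simp_all

text \<open>The constants 0 and 1 and the zero vector appear through codes, in the form that the
  decision procedures for coded equalities accept.\<close>

lemma vsat_decode1:
  "vsat i [decode a] \<longleftrightarrow> odd a \<and> (i = 0 \<or> i = 6 \<and> vec_of_code (a div 2) = vec_of_code 0) \<or>
    even a \<and> (i = 1 \<or> i = 2 \<and> rat_of_code (a div 2) = rat_of_code (rat_code 0)
      \<or> i = 3 \<and> rat_of_code (a div 2) = rat_of_code (rat_code 1))"
  by (auto simp: decode_def rat_of_code_inverse vec_of_code_0)

lemma vsat_decode3:
  "vsat i [decode a, decode b, decode c] \<longleftrightarrow>
    even a \<and> even b \<and> even c \<and>
      (i = 4 \<and> rat_of_code (a div 2) + rat_of_code (b div 2) = rat_of_code (c div 2) \<or>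
       i = 5 \<and> rat_of_code (a div 2) * rat_of_code (b div 2) = rat_of_code (c div 2)) \<or>
    odd a \<and> odd b \<and> odd c \<and> i = 7 \<and>
       (\<lambda>j. vec_of_code (a div 2) j + vec_of_code (b div 2) j) = vec_of_code (c div 2) \<or>
    even a \<and> odd b \<and> odd c \<and> i = 8 \<and>
       (\<lambda>j. rat_of_code (a div 2) * vec_of_code (b div 2) j) = vec_of_code (c div 2)"
  by (auto simp: decode_def)

lemma decidable_vsat1:
  "computable k f \<Longrightarrow> computable k g \<Longrightarrow> decidable k (\<lambda>xs. vsat (f xs) [decode (g xs)])"
  unfolding vsat_decode1 by (intro computability_intros decidable_rat_eq decidable_vec_eq)

lemma decidable_vsat3:
  "computable k f \<Longrightarrow> computable k g \<Longrightarrow> computable k h \<Longrightarrow> computable k l \<Longrightarrow>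
    decidable k (\<lambda>xs. vsat (f xs) [decode (g xs), decode (h xs), decode (l xs)])"
  unfolding vsat_decode3
  by (intro computability_intros decidable_rat_add decidable_rat_mult decidable_vec_add decidable_vec_scale)

text \<open>The three clauses treat equalities, unary symbols and ternary symbols. Even and odd
  second components are the two injections of \<open>sum_encode\<close>, nested successors of pairs
  are \<open>list_encode\<close>, and the quantifiers can be bounded by \<open>l\<close> because
  arguments never exceed the code containing them.\<close>

definition literal_ok :: "nat \<Rightarrow> nat \<Rightarrow> bool" where
  "literal_ok s l \<longleftrightarrow>
    (\<exists>a<Suc l. \<exists>b<Suc l. in_universe s a \<and> in_universe s b \<and>
       l = prod_encode (of_bool (a = b), 2 * prod_encode (a, b))) \<or>
    (\<exists>i<9. \<exists>a<Suc l. (i < 4 \<or> i = 6) \<and> in_universe s a \<and>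
       l = prod_encode (of_bool (vsat i [decode a]), Suc (2 * prod_encode (i, Suc (prod_encode (a, 0)))))) \<or>
    (\<exists>i<9. \<exists>a<Suc l. \<exists>b<Suc l. \<exists>c<Suc l. \<not> (i < 4 \<or> i = 6) \<and>
       in_universe s a \<and> in_universe s b \<and> in_universe s c \<and>
       l = prod_encode (of_bool (vsat i [decode a, decode b, decode c]),
         Suc (2 * prod_encode (i, Suc (prod_encode (a, Suc (prod_encode (b, Suc (prod_encode (c, 0))))))))))"

lemma decidable_literal_ok:
  assumes "computable k f" "computable k g" shows "decidable k (\<lambda>xs. literal_ok (f xs) (g xs))"
proof (rule decidable_compose2[OF _ assms])
  have "decidable (Suc (Suc 0)) (\<lambda>xs. literal_ok (xs ! 0) (xs ! 1))"
    unfolding literal_ok_def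
    by (intro computability_intros decidable_in_universe decidable_vsat1 decidable_vsat3 computable_tl) simp_all
  then show "decidable 2 (\<lambda>xs. literal_ok (xs ! 0) (xs ! 1))" by (simp add: numeral_2_eq_2)
qed

lemma less_Suc_prod_encode:
  "a < Suc l \<Longrightarrow> a < Suc (prod_encode (l, m))" "a < Suc l \<Longrightarrow> a < Suc (prod_encode (m, l))"
  by (simp_all add: less_Suc_eq_le order_trans[OF _ le_prod_encode_1] order_trans[OF _ le_prod_encode_2])

lemma fvs_sig_arity:
  "i < length fvs_sig \<Longrightarrow> fvs_sig ! i = (if i < 4 \<or> i = 6 then 1 else 3)"
proof -
  assume "i < length fvs_sig"
  then have "i \<in> set [0..<9]" by (simp add: fvs_sig_def)
  then have "i \<in> {0, 1, 2, 3, 4, 5, 6, 7, 8}" by (simp add: upt_rec numeral_eq_Suc)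
  then show ?thesis by (auto simp: fvs_sig_def)
qed

lemma holds_vspace_code:
  assumes "set ys \<subseteq> code ` elems (named s)"
  shows "holds (vspace code (named s)) (Rel i ys) \<longleftrightarrow> vsat i (map decode ys)"
proof -
  obtain xs where xs: "set xs \<subseteq> elems (named s)" "ys = map code xs"
    using assms by (rule list_over_image)
  have "map decode ys = xs"
    unfolding xs(2) map_map using xs(1) decode_code[OF finite_named] by (intro map_idI) auto
  then show ?thesis
    using map_mem_vspace_iff[OF inj_code[OF finite_named] xs(1)] xs(2) by simp
qed

lemma literal_ok_iff: "literal_ok s l \<longleftrightarrow> l \<in> lit_code ` diag fvs_sig (vspace code (named s))"
proof
  let ?V = "vspace code (named s)"
  have U: "fst ?V = code ` elems (named s)" by (simp add: vspace_def)
  {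
    assume "l \<in> lit_code ` diag fvs_sig ?V"
    then obtain x where x: "x \<in> atoms fvs_sig (fst ?V)" "l = lit_code (holds ?V x, x)"
      by (auto simp: diag_def)
    show "literal_ok s l"
    proof (cases x)
      case (Eq a b)
      have l: "l = prod_encode (of_bool (a = b), 2 * prod_encode (a, b))"
        using x(2) Eq by (simp add: lit_code_def sum_encode_def)
      moreover have "in_universe s a" "in_universe s b"
        using x(1) Eq by (auto simp: atoms_def in_universe_iff U)
      moreover have "a \<le> prod_encode (a, b)" "b \<le> prod_encode (a, b)"
        by (simp_all add: le_prod_encode_1 le_prod_encode_2)
      then have "a < Suc l" "b < Suc l" unfolding l
        by (auto intro!: less_Suc_prod_encode(2))
      ultimately show ?thesis unfolding literal_ok_def
        by (intro disjI1 exI[of _ a] exI[of _ b] conjI) assumption+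
    next
      case (Rel i ys)
      have ys: "i < 9" "length ys = (if i < 4 \<or> i = 6 then 1 else 3)" "set ys \<subseteq> code ` elems (named s)"
        using x(1) Rel fvs_sig_arity[of i] by (auto simp: atoms_def U fvs_sig_def)
      have l: "l = prod_encode (of_bool (vsat i (map decode ys)), Suc (2 * prod_encode (i, list_encode ys)))"
        using x(2) Rel holds_vspace_code[OF ys(3)] by (simp add: lit_code_def sum_encode_def)
      show ?thesis
      proof (cases "i < 4 \<or> i = 6")
        case True
        then obtain a where a: "ys = [a]" using ys(2) by (auto simp: length_Suc_conv)
        have "a < Suc (prod_encode (a, 0))" by (intro less_Suc_prod_encode) simp
        then have "a < Suc (prod_encode (i, Suc (prod_encode (a, 0))))" by (intro less_Suc_prod_encode) simp
        then have "a < Suc l" unfolding l a by (auto intro!: less_Suc_prod_encode(2))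
        moreover have "in_universe s a" using ys(3) a by (simp add: in_universe_iff)
        moreover have "l = prod_encode (of_bool (vsat i [decode a]),
            Suc (2 * prod_encode (i, Suc (prod_encode (a, 0)))))"
          using l a by simp
        ultimately show ?thesis using True ys(1) unfolding literal_ok_def
          by (intro disjI2[OF disjI1] exI[of _ i] exI[of _ a] conjI) assumption+
      next
        case False
        then obtain a b c where abc: "ys = [a, b, c]"
          using ys(2) by (auto simp: length_Suc_conv numeral_3_eq_3)
        have *: "x < Suc l" if "x < Suc (list_encode ys)" for x
        proof -
          have "x < Suc (prod_encode (i, list_encode ys))" using that by (rule less_Suc_prod_encode)
          then show ?thesis unfolding l by (auto intro!: less_Suc_prod_encode(2))
        qed
        have "a < Suc (list_encode ys)" "b < Suc (list_encode ys)" "c < Suc (list_encode ys)"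
          unfolding abc by (simp_all add: less_Suc_prod_encode less_SucI)
        then have "a < Suc l" "b < Suc l" "c < Suc l" using * by blast+
        moreover have "in_universe s a" "in_universe s b" "in_universe s c"
          using ys(3) abc by (simp_all add: in_universe_iff)
        moreover have "l = prod_encode (of_bool (vsat i [decode a, decode b, decode c]),
         Suc (2 * prod_encode (i, Suc (prod_encode (a, Suc (prod_encode (b, Suc (prod_encode (c, 0)))))))))"
          using l abc by simp
        ultimately show ?thesis using False ys(1) unfolding literal_ok_def
          by (intro disjI2[OF disjI2] exI[of _ i] exI[of _ a] exI[of _ b] exI[of _ c] conjI) assumption+
      qed
    qed
  }
  {
    assume "literal_ok s l"
    \<comment> \<open>The unary and the ternary clause are merged into one case with an argument
      list.\<close>
    then consider
      (eq) a b where "in_universe s a" "in_universe s b" "l = prod_encode (of_bool (a = b), 2 * prod_encode (a, b))"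
    | (rel) i ys where "i < 9" "length ys = (if i < 4 \<or> i = 6 then 1 else 3)" "\<forall>y\<in>set ys. in_universe s y"
        "l = prod_encode (of_bool (vsat i (map decode ys)), Suc (2 * prod_encode (i, list_encode ys)))"
    proof -
      consider (eq) a b where "in_universe s a" "in_universe s b"
          "l = prod_encode (of_bool (a = b), 2 * prod_encode (a, b))"
      | (un) i a where "i < 9" "i < 4 \<or> i = 6" "in_universe s a"
          "l = prod_encode (of_bool (vsat i [decode a]), Suc (2 * prod_encode (i, Suc (prod_encode (a, 0)))))"
      | (tern) i a b c where "i < 9" "\<not> (i < 4 \<or> i = 6)"
          "in_universe s a" "in_universe s b" "in_universe s c"
          "l = prod_encode (of_bool (vsat i [decode a, decode b, decode c]),
         Suc (2 * prod_encode (i, Suc (prod_encode (a, Suc (prod_encode (b, Suc (prod_encode (c, 0)))))))))"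
        using \<open>literal_ok s l\<close> unfolding literal_ok_def by blast
      then show thesis
      proof cases
        case eq
        then show ?thesis by (rule that(1))
      next
        case un
        then show ?thesis by (intro that(2)[of i "[a]"]) auto
      next
        case tern
        then show ?thesis by (intro that(2)[of i "[a, b, c]"]) auto
      qed
    qed
    then show "l \<in> lit_code ` diag fvs_sig ?V"
    proof cases
      case eq
      then have "Eq a b \<in> atoms fvs_sig (fst ?V)" by (auto simp: atoms_def in_universe_iff U)
      then have "(holds ?V (Eq a b), Eq a b) \<in> diag fvs_sig ?V" unfolding diag_def by blast
      moreover have "lit_code (holds ?V (Eq a b), Eq a b) = l"
        using eq by (simp add: lit_code_def sum_encode_def)
      ultimately show ?thesis by blast
    next
      case rel
      then have ys: "set ys \<subseteq> code ` elems (named s)" by (auto simp: in_universe_iff)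
      then have "Rel i ys \<in> atoms fvs_sig (fst ?V)"
        using rel fvs_sig_arity[of i] by (auto simp: atoms_def U fvs_sig_def)
      then have "(holds ?V (Rel i ys), Rel i ys) \<in> diag fvs_sig ?V" unfolding diag_def by blast
      moreover have "lit_code (holds ?V (Rel i ys), Rel i ys) = l"
        using rel holds_vspace_code[OF ys] by (simp add: lit_code_def sum_encode_def)
      ultimately show ?thesis by blast
    qed
  }
qed

section \<open>The transformation of orders into vector spaces\<close>

text \<open>The premises record only which elements exist and never how they are ordered: a finite
  order is determined up to isomorphism by its size. Each premise set contributes the whole diagram
  of the space it spans.\<close>

definition basis_trans :: "(lit set \<times> lit) set" where
  "basis_trans = {(\<alpha>, \<phi>). finite \<alpha> \<and> \<alpha> \<subseteq> range (\<lambda>a. (True, Eq a a)) \<and>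
     \<phi> \<in> diag fvs_sig (vspace code {a. (True, Eq a a) \<in> \<alpha>})}"

lemma mem_set_decode_le: "j \<in> set_decode s \<Longrightarrow> j < Suc s"
proof (rule ccontr)
  assume "j \<in> set_decode s" "\<not> j < Suc s"
  then have "s < 2 ^ j" using less_exp[of j] by linarith
  then show False using \<open>j \<in> set_decode s\<close> by (simp add: set_decode_def)
qed

text \<open>A form with bounded quantifiers, from which decidability follows: the first component
  must consist of reflexive equalities, and members of a set are smaller than its binary
  code.\<close>

lemma pair_code_basis_trans:
  "pair_code ` basis_trans = {n. (\<forall>j<Suc (pfst n). j \<in> set_decode (pfst n) \<longrightarrow> (\<exists>a<Suc j. j = eq_code a))
     \<and> literal_ok (pfst n) (psnd n)}" (is "_ = {n. ?P n}")
proof (intro equalityI subsetI)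
  fix n assume "n \<in> pair_code ` basis_trans"
  then obtain \<alpha> \<phi> where \<alpha>: "finite \<alpha>" "\<alpha> \<subseteq> range (\<lambda>a. (True, Eq a a))"
    and \<phi>: "\<phi> \<in> diag fvs_sig (vspace code {a. (True, Eq a a) \<in> \<alpha>})" and n: "n = pair_code (\<alpha>, \<phi>)"
    by (auto simp: basis_trans_def)
  have s: "set_decode (pfst n) = lit_code ` \<alpha>" and l: "psnd n = lit_code \<phi>"
    using \<alpha>(1) by (simp_all add: n pair_code_def)
  have codes: "lit_code ` \<alpha> = eq_code ` {a. (True, Eq a a) \<in> \<alpha>}"
    using \<alpha>(2) by (auto simp: eq_code_def image_iff)
  have "named (pfst n) = {a. (True, Eq a a) \<in> \<alpha>}"
    unfolding named_def s codes by auto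
  then have "literal_ok (pfst n) (psnd n)" using \<phi> by (simp add: literal_ok_iff l)
  moreover have "\<exists>a<Suc j. j = eq_code a" if j: "j \<in> set_decode (pfst n)" for j
  proof -
    obtain a where a: "j = eq_code a" using j unfolding s codes by blast
    have "a < Suc (prod_encode (a, a))" by (intro less_Suc_prod_encode) simp
    then have "a < Suc j" unfolding a eq_code_eq by (intro less_Suc_prod_encode) simp
    then show ?thesis using a by blast
  qed
  ultimately show "n \<in> {n. ?P n}" by blast
next
  fix n assume "n \<in> {n. ?P n}"
  then have s: "\<And>j. j \<in> set_decode (pfst n) \<Longrightarrow> \<exists>a. j = eq_code a" and l: "literal_ok (pfst n) (psnd n)"
    using mem_set_decode_le by blast+
  \<comment> \<open>The premise set is rebuilt from the names it mentions; nothing is lost, since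
    every coded member is a reflexive equality.\<close>
  define \<alpha> :: "lit set" where "\<alpha> = (\<lambda>a. (True, Eq a a)) ` named (pfst n)"
  have \<alpha>: "{a. (True, Eq a a) \<in> \<alpha>} = named (pfst n)" by (auto simp: \<alpha>_def)
  have "lit_code ` \<alpha> = eq_code ` named (pfst n)"
    unfolding \<alpha>_def image_image eq_code_def ..
  also have "\<dots> = set_decode (pfst n)" using s by (auto simp: named_def)
  finally have codes: "set_encode (lit_code ` \<alpha>) = pfst n" by simp
  obtain \<phi> where \<phi>: "\<phi> \<in> diag fvs_sig (vspace code (named (pfst n)))" "psnd n = lit_code \<phi>"
    using l unfolding literal_ok_iff by blast
  have "(\<alpha>, \<phi>) \<in> basis_trans"
    using \<phi>(1) unfolding basis_trans_def by (auto simp: \<alpha>) (auto simp: \<alpha>_def finite_named)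
  moreover have "n = pair_code (\<alpha>, \<phi>)"
    using \<phi>(2) codes by (simp add: pair_code_def flip: \<phi>(2))
  ultimately show "n \<in> pair_code ` basis_trans" by blast
qed

lemma ce_basis_trans: "ce (pair_code ` basis_trans)"
  unfolding pair_code_basis_trans
proof (rule decidable_imp_ce)
  have "decidable (Suc 0) (\<lambda>xs.
      (\<forall>j<Suc (pfst (xs ! 0)). j \<in> set_decode (pfst (xs ! 0)) \<longrightarrow> (\<exists>a<Suc j. j = eq_code a))
      \<and> literal_ok (pfst (xs ! 0)) (psnd (xs ! 0)))"
    unfolding eq_code_eq
    by (intro computability_intros decidable_literal_ok computable_tl) simp_all
  then show "decidable 1 (\<lambda>xs.
      (\<forall>j<Suc (pfst (xs ! 0)). j \<in> set_decode (pfst (xs ! 0)) \<longrightarrow> (\<exists>a<Suc j. j = eq_code a))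
      \<and> literal_ok (pfst (xs ! 0)) (psnd (xs ! 0)))" by simp
qed

text \<open>The whole universe is finite and hence itself available as a premise set; smaller
  premise sets add nothing, by monotonicity of the diagrams.\<close>

lemma apply_basis_trans:
  assumes "finite (fst A)"
  shows "apply_trans flo_sig basis_trans A = diag fvs_sig (vspace code (fst A))"
proof (intro equalityI subsetI)
  fix \<phi> assume "\<phi> \<in> apply_trans flo_sig basis_trans A"
  then obtain \<alpha> where \<alpha>: "\<alpha> \<subseteq> diag flo_sig A" "\<phi> \<in> diag fvs_sig (vspace code {a. (True, Eq a a) \<in> \<alpha>})"
    by (auto simp: apply_trans_def basis_trans_def)
  have "{a. (True, Eq a a) \<in> \<alpha>} \<subseteq> fst A" using \<alpha>(1) fst_eq_diag[of A flo_sig] by blast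
  then show "\<phi> \<in> diag fvs_sig (vspace code (fst A))"
    using \<alpha>(2) diag_vspace_mono[OF inj_code[OF assms]] by blast
next
  fix \<phi> assume \<phi>: "\<phi> \<in> diag fvs_sig (vspace code (fst A))"
  define \<alpha> :: "lit set" where "\<alpha> = (\<lambda>a. (True, Eq a a)) ` fst A"
  have \<alpha>: "{a. (True, Eq a a) \<in> \<alpha>} = fst A" by (auto simp: \<alpha>_def)
  have "(\<alpha>, \<phi>) \<in> basis_trans"
    using \<phi> unfolding basis_trans_def by (auto simp: \<alpha>) (auto simp: \<alpha>_def assms)
  moreover have "\<alpha> \<subseteq> diag flo_sig A" using fst_eq_diag[of A flo_sig] by (auto simp: \<alpha>_def)
  ultimately show "\<phi> \<in> apply_trans flo_sig basis_trans A" unfolding apply_trans_def by blast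
qed

text \<open>An embedding is tested on arbitrary structures having the output diagram. This
  identifies them with the intended space; interpretations being empty outside the signature is what
  gives full equality.\<close>

lemma diag_inject:
  assumes A: "is_struc L A" and B: "is_struc L B" and eq: "diag L A = diag L B"
  shows "A = B"
proof (rule prod_eqI)
  show fst: "fst A = fst B" using fst_eq_diag[of _ L] eq by metis
  have *: "xs \<in> snd C i \<longleftrightarrow> (True, Rel i xs) \<in> diag L C" if C: "is_struc L C" for C i xs
  proof -
    have "(True, Rel i xs) \<in> diag L C \<longleftrightarrow> xs \<in> snd C i \<and> Rel i xs \<in> atoms L (fst C)"
      by (auto simp: diag_def)
    moreover have "Rel i xs \<in> atoms L (fst C) \<longleftrightarrow> i < length L \<and> length xs = L ! i \<and> set xs \<subseteq> fst C"
      by (simp add: atoms_def)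
    moreover have "i < length L \<and> length xs = L ! i \<and> set xs \<subseteq> fst C" if "xs \<in> snd C i"
      using C that unfolding is_struc_def by (metis empty_iff not_le)
    ultimately show ?thesis by blast
  qed
  show "snd A = snd B"
    by (rule ext, rule set_eqI) (simp only: *[OF A] *[OF B] eq)
qed

lemma lit_in_lang_diag: "l \<in> diag L A \<Longrightarrow> lit_in_lang L l"
  by (auto simp: diag_def atoms_def)

lemma FLO_le_FVS: "le_c flo_sig FLO fvs_sig FVS"
  unfolding le_c_def
proof (intro exI[of _ basis_trans])
  have fin: "finite (fst A)" if "A \<in> FLO" for A using that by (simp add: FLO_def)
  have "\<exists>B. is_struc flo_sig B \<and> finite (fst B) \<and> \<alpha> \<subseteq> diag flo_sig B"
    if "finite \<alpha>" "\<alpha> \<subseteq> range (\<lambda>a. (True, Eq a a))" for \<alpha>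
  proof -
    \<comment> \<open>Premises must be realised in some finite structure for the language, not
      necessarily an order, so the empty relation will do.\<close>
    let ?B = "({a. (True, Eq a a) \<in> \<alpha>}, \<lambda>_. {}) :: struc"
    have "{a. (True, Eq a a) \<in> \<alpha>} = (\<lambda>a. (True, Eq a a)) -` \<alpha>" by auto
    then have "finite (fst ?B)" using that(1) by (simp add: finite_vimageI inj_def)
    moreover have "is_struc flo_sig ?B" by (simp add: is_struc_def)
    moreover have "\<alpha> \<subseteq> diag flo_sig ?B" using that(2) fst_eq_diag[of ?B flo_sig] by auto
    ultimately show ?thesis by blast
  qed
  then have "comp_trans flo_sig FLO fvs_sig FVS basis_trans"
    unfolding comp_trans_def
    using ce_basis_trans apply_basis_trans[OF fin] vspace_in_FVS[OF fin inj_code[OF fin]]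
    by (auto simp: basis_trans_def lit_in_lang_diag)
  moreover have "iso flo_sig A A' \<longleftrightarrow> iso fvs_sig B B'"
    if AA: "A \<in> FLO" "A' \<in> FLO" and BB: "is_struc fvs_sig B" "is_struc fvs_sig B'"
      "apply_trans flo_sig basis_trans A = diag fvs_sig B"
      "apply_trans flo_sig basis_trans A' = diag fvs_sig B'" for A A' B B'
  proof -
    have "B = vspace code (fst A)"
      using BB(3) apply_basis_trans[OF fin[OF AA(1)]] by (intro diag_inject[OF BB(1) is_struc_vspace]) simp
    moreover have "B' = vspace code (fst A')"
      using BB(4) apply_basis_trans[OF fin[OF AA(2)]] by (intro diag_inject[OF BB(2) is_struc_vspace]) simp
    ultimately have "iso fvs_sig B B' \<longleftrightarrow> card (fst A) = card (fst A')"
      using iso_vspace_iff inj_code fin AA by blast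
    \<comment> \<open>On both sides isomorphism has become equality of the size of the universe of
      the order, which is the dimension of the space.\<close>
    moreover have "iso flo_sig A A' \<longleftrightarrow> card (fst A) = card (fst A')"
      using FLO_iso_same_card[OF AA] unfolding iso_def by (metis bij_betw_same_card)
    ultimately show ?thesis by simp
  qed
  ultimately show "comp_emb flo_sig FLO fvs_sig FVS basis_trans"
    unfolding comp_emb_def by blast
qed

theorem theorem2p6:
  shows "le_c flo_sig FLO fvs_sig FVS \<and> \<not> le_c fvs_sig FVS flo_sig FLO"
  using FLO_le_FVS FVS_not_le_FLO by blast

end
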